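(* Let $d\ge 1$. If $g:\mathbb{R}\times\mathbb{R}^d\to\mathbb{C}$ is harmonic, then there exists a harmonic function $h:\mathbb{R}\times\mathbb{R}^d\to\mathbb{C}$ such that $$h(t+1,y)-h(t,y)=g(t,y)$$ for all $t\in\mathbb{R}$ and $y\in\mathbb{R}^d$.
   Context: A complex-valued function on an open subset of a Euclidean space is harmonic if it is twice continuously differentiable and its Laplacian vanishes identically. Here $\mathbb{R}\times\mathbb{R}^d$ is identified with $\mathbb{R}^{d+1}$, so harmonicity is with respect to all $d+1$ variables $(t,y)$. *)

theory Defs
  imports "HOL-Analysis.Analysis"
begin

definition partial_deriv ::
  "'a::euclidean_space \<Rightarrow> ('a \<Rightarrow> 'b::real_normed_vector) \<Rightarrow> 'a \<Rightarrow> 'b"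
  where "partial_deriv b f x = vector_derivative (\<lambda>s. f (x + s *\<^sub>R b)) (at 0)"

(* On a product type, Basis consists of the vectors (u, 0) and (0, v) with u and v in the
   Basis of the factors, so the sum below runs over all coordinates of both factors. *)
definition laplacian ::
  "('a::euclidean_space \<Rightarrow> 'b::real_normed_vector) \<Rightarrow> 'a \<Rightarrow> 'b"
  where "laplacian f x = (\<Sum>b\<in>Basis. partial_deriv b (partial_deriv b f) x)"

definition twice_continuously_differentiable_on ::
  "'a::euclidean_space set \<Rightarrow> ('a \<Rightarrow> 'b::real_normed_vector) \<Rightarrow> bool"
  where "twice_continuously_differentiable_on U f \<longleftrightarrow>
    (\<exists>(f' :: 'a \<Rightarrow> 'a \<Rightarrow>\<^sub>L 'b) (f'' :: 'a \<Rightarrow> 'a \<Rightarrow>\<^sub>L 'a \<Rightarrow>\<^sub>L 'b).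
      (\<forall>x\<in>U. (f has_derivative blinfun_apply (f' x)) (at x)) \<and>
      (\<forall>x\<in>U. (f' has_derivative blinfun_apply (f'' x)) (at x)) \<and>
      continuous_on U f'')"

definition harmonic_on ::
  "'a::euclidean_space set \<Rightarrow> ('a \<Rightarrow> complex) \<Rightarrow> bool"
  where "harmonic_on U f \<longleftrightarrow>
    open U \<and> twice_continuously_differentiable_on U f \<and> (\<forall>x\<in>U. laplacian f x = 0)"

end

theory Submission
  imports Defs "HOL-Complex_Analysis.Complex_Analysis"
begin

text \<open>
  For entire functions of one complex variable the equation \<open>G (z + 1) - G z = f z\<close> is solved
  by a theorem of Guichard and Hurwitz. The harmonic case is reduced to it by plane waves: if \<open>\<omega>\<close> is
  a unit vector and \<open>F\<close> is entire, then \<open>F (t + i (y \<bullet> \<omega>))\<close> is harmonic, and a shift of \<open>t\<close> is a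
  shift of the complex variable. So it suffices to write \<open>g\<close> as a series of waves
  \<open>c (t + i (y \<bullet> \<omega>))\<^sup>k\<close> and to replace each power \<open>z\<^sup>k\<close> by an entire \<open>G\<^sub>k\<close> with
  \<open>G\<^sub>k (z + 1) - G\<^sub>k z = z\<^sup>k\<close>. Two quantitative facts make the resulting series converge.

  First, \<open>G\<^sub>k\<close> can be chosen to grow only geometrically in \<open>k\<close> on every disc (\<open>guichard_difference\<close>,
  \<open>guichard_bound\<close>); the Bernoulli polynomials would not do. Second, the absolute sums of the
  coefficients \<open>c\<close> in degree \<open>k\<close> decay faster than every geometric sequence. To see this, the
  mean value property with a radial kernel (\<open>harmonic_average_radius\<close>) gives Cauchy estimates on
  balls of every radius (\<open>gradient_estimate\<close>), hence Taylor series with rapidly decaying coefficients.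
  On the hyperplane \<open>t = 0\<close> the Taylor series of \<open>g\<close> and of its derivative in \<open>t\<close> are rewritten as
  series of powers \<open>(y \<bullet> \<omega>)\<^sup>k\<close> by \<open>polarization\<close>; this costs only geometric factors
  (\<open>slice_expansion\<close>).

  Each such series extends to a series of plane waves with prescribed value and zero normal
  derivative on the hyperplane, or with zero value and prescribed normal derivative
  (\<open>even_wave_extension\<close>, \<open>odd_wave_extension\<close>). A harmonic function is determined by these Cauchy data
  (\<open>harmonic_eq_0_from_cauchy_data\<close>), so the sum of the two extensions is \<open>g\<close>. The solution is harmonic
  because locally dominated series of harmonic functions are harmonic (\<open>harmonic_suminf\<close>).
\<close>

section \<open>Harmonic functions and partial derivatives\<close>

text \<open>
  For a function with a total derivative the directional derivative is its value in that direction;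
  after this lemma \<open>partial_deriv v f\<close> can be used for every vector \<open>v\<close>, linearly in \<open>v\<close>.
\<close>

lemma partial_deriv_eq:
  assumes "(f has_derivative f') (at x)"
  shows "partial_deriv v f x = f' v"
proof -
  have "((\<lambda>s. x + s *\<^sub>R v) has_derivative (\<lambda>s. s *\<^sub>R v)) (at (0::real))"
    by (auto intro!: derivative_eq_intros)
  then have "((\<lambda>s. f (x + s *\<^sub>R v)) has_derivative (\<lambda>s. f' (s *\<^sub>R v))) (at 0)"
    by (rule has_derivative_compose) (use assms in simp)
  moreover have "f' (s *\<^sub>R v) = s *\<^sub>R f' v" for s
    by (rule linear_scale[OF bounded_linear.linear[OF has_derivative_bounded_linear[OF assms]]])
  ultimately have "((\<lambda>s. f (x + s *\<^sub>R v)) has_vector_derivative f' v) (at 0)"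
    by (simp add: has_vector_derivative_def)
  then show ?thesis
    unfolding partial_deriv_def by (rule vector_derivative_at)
qed

text \<open>
  The second derivative is packaged as a bounded linear map, and the Laplacian becomes its trace.
  In this form harmonicity passes through integrals and series, because the trace is a bounded
  linear functional of the second derivative.
\<close>

lemma harmonicE:
  fixes f :: "'a::euclidean_space \<Rightarrow> complex"
  assumes "harmonic_on UNIV f"
  obtains f' :: "'a \<Rightarrow> 'a \<Rightarrow>\<^sub>L complex" and f'' :: "'a \<Rightarrow> 'a \<Rightarrow>\<^sub>L 'a \<Rightarrow>\<^sub>L complex"
  where "\<And>x. (f has_derivative f' x) (at x)" "\<And>x. (f' has_derivative f'' x) (at x)"
    "continuous_on UNIV f''" "\<And>x. (\<Sum>b\<in>Basis. f'' x b b) = 0"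
    "\<And>v x. partial_deriv v f x = f' x v" 
    "\<And>v w x. partial_deriv v (partial_deriv w f) x = f'' x v w"
proof -
  obtain f' :: "'a \<Rightarrow> 'a \<Rightarrow>\<^sub>L complex" and f'' :: "'a \<Rightarrow> 'a \<Rightarrow>\<^sub>L 'a \<Rightarrow>\<^sub>L complex"
    where 1: "\<And>x. (f has_derivative f' x) (at x)" and 2: "\<And>x. (f' has_derivative f'' x) (at x)"
      and 3: "continuous_on UNIV f''"
    using assms unfolding harmonic_on_def twice_continuously_differentiable_on_def by blast
  have 4: "partial_deriv v f x = f' x v" for v x
    using partial_deriv_eq[OF 1] .
  have 5: "partial_deriv v (partial_deriv w f) x = f'' x v w" for v w x
  proof -
    have "partial_deriv w f = (\<lambda>x. f' x w)" using 4 by auto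
    moreover have "((\<lambda>x. f' x w) has_derivative (\<lambda>v. f'' x v w)) (at x)"
      using 2[of x] by (auto intro!: derivative_eq_intros)
    ultimately show ?thesis using partial_deriv_eq by metis
  qed
  have "(\<Sum>b\<in>Basis. f'' x b b) = 0" for x
    using assms unfolding harmonic_on_def laplacian_def 5 by simp
  with 1 2 3 4 5 show ?thesis using that by blast
qed

lemma harmonicI:
  fixes f :: "'a::euclidean_space \<Rightarrow> complex"
    and f' :: "'a \<Rightarrow> 'a \<Rightarrow>\<^sub>L complex" and f'' :: "'a \<Rightarrow> 'a \<Rightarrow>\<^sub>L 'a \<Rightarrow>\<^sub>L complex"
  assumes "\<And>x. (f has_derivative f' x) (at x)" "\<And>x. (f' has_derivative f'' x) (at x)"
    "continuous_on UNIV f''" "\<And>x. (\<Sum>b\<in>Basis. f'' x b b) = 0"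
  shows "harmonic_on UNIV f"
proof -
  have "partial_deriv w f = (\<lambda>x. f' x w)" for w
    using partial_deriv_eq[OF assms(1)] by auto
  moreover have "((\<lambda>x. f' x w) has_derivative (\<lambda>v. f'' x v w)) (at x)" for x w
    using assms(2)[of x] by (auto intro!: derivative_eq_intros)
  ultimately have "laplacian f x = (\<Sum>b\<in>Basis. f'' x b b)" for x
    unfolding laplacian_def by (metis (no_types, lifting) partial_deriv_eq)
  with assms show ?thesis
    unfolding harmonic_on_def twice_continuously_differentiable_on_def by auto
qed

lemma harmonic_differentiable:
  fixes f :: "'a::euclidean_space \<Rightarrow> complex"
  assumes "harmonic_on UNIV f"
  shows "(f has_derivative (\<lambda>v. partial_deriv v f x)) (at x)"
  by (rule harmonicE[OF assms]) simp

lemma harmonic_continuous: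
  fixes f :: "'a::euclidean_space \<Rightarrow> complex"
  assumes "harmonic_on UNIV f"
  shows "continuous_on A f"
  using harmonic_differentiable[OF assms] 
  by (meson continuous_at_imp_continuous_on has_derivative_continuous)

lemma harmonic_add:
  fixes f g :: "'a::euclidean_space \<Rightarrow> complex"
  assumes "harmonic_on UNIV f" "harmonic_on UNIV g"
  shows "harmonic_on UNIV (\<lambda>x. f x + g x)"
proof (rule harmonicE[OF assms(1)], rule harmonicE[OF assms(2)])
  fix f' f'' g' g''
  assume f: "\<And>x. (f has_derivative blinfun_apply (f' x)) (at x)" "\<And>x. (f' has_derivative blinfun_apply (f'' x)) (at x)"
    "continuous_on UNIV f''" "\<And>x. (\<Sum>b\<in>Basis. f'' x b b) = 0"
   and g: "\<And>x. (g has_derivative blinfun_apply (g' x)) (at x)" "\<And>x. (g' has_derivative blinfun_apply (g'' x)) (at x)"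
    "continuous_on UNIV g''" "\<And>x. (\<Sum>b\<in>Basis. g'' x b b) = 0"
  show ?thesis
    by (rule harmonicI[where f' = "\<lambda>x. f' x + g' x" and f'' = "\<lambda>x. f'' x + g'' x"])
      (auto intro!: derivative_eq_intros continuous_intros f g 
        simp: blinfun.add_left fun_eq_iff sum.distrib f(4) g(4))
qed

lemma harmonic_mult:
  fixes f :: "'a::euclidean_space \<Rightarrow> complex"
  assumes "harmonic_on UNIV f"
  shows "harmonic_on UNIV (\<lambda>x. c * f x)"
proof (rule harmonicE[OF assms(1)])
  fix f' f''
  assume f: "\<And>x. (f has_derivative blinfun_apply (f' x)) (at x)" "\<And>x. (f' has_derivative blinfun_apply (f'' x)) (at x)"
    "continuous_on UNIV f''" "\<And>x. (\<Sum>b\<in>Basis. f'' x b b) = 0"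
  define m where "m = blinfun_mult_right c"
  define L where "L = (Blinfun (\<lambda>A :: 'a \<Rightarrow>\<^sub>L complex. m o\<^sub>L A))"
  have L: "blinfun_apply L A = m o\<^sub>L A" for A
    unfolding L_def by (subst bounded_linear_Blinfun_apply) (auto intro!: bounded_linear_intros)
  show ?thesis
    by (rule harmonicI[where f' = "\<lambda>x. m o\<^sub>L f' x" and f'' = "\<lambda>x. L o\<^sub>L f'' x"])
      (auto intro!: derivative_eq_intros continuous_intros f
        simp: m_def L fun_eq_iff simp flip: sum_distrib_left f(4))
qed

lemma harmonic_zero: "harmonic_on UNIV (\<lambda>x::'a::euclidean_space. 0)"
  by (rule harmonicI[where f' = "\<lambda>x. 0" and f'' = "\<lambda>x. 0"]) (auto simp: zero_blinfun.rep_eq)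

lemma harmonic_sum:
  fixes f :: "'i \<Rightarrow> 'a::euclidean_space \<Rightarrow> complex"
  assumes "\<And>i. i \<in> I \<Longrightarrow> harmonic_on UNIV (f i)"
  shows "harmonic_on UNIV (\<lambda>x. \<Sum>i\<in>I. f i x)"
  using assms by (induction I rule: infinite_finite_induct) (auto intro: harmonic_add harmonic_zero)

lemma harmonic_diff:
  fixes f g :: "'a::euclidean_space \<Rightarrow> complex"
  assumes "harmonic_on UNIV f" "harmonic_on UNIV g"
  shows "harmonic_on UNIV (\<lambda>x. f x - g x)"
  using harmonic_add[OF assms(1) harmonic_mult[OF assms(2), of "-1"]] by simp

lemma partial_deriv_sum_mult:
  fixes f :: "'i \<Rightarrow> 'a::euclidean_space \<Rightarrow> complex"
  assumes "\<And>i. i \<in> I \<Longrightarrow> harmonic_on UNIV (f i)"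
  shows "partial_deriv v (\<lambda>x. \<Sum>i\<in>I. c i * f i x) x = (\<Sum>i\<in>I. c i * partial_deriv v (f i) x)"
proof (rule partial_deriv_eq)
  show "((\<lambda>x. \<Sum>i\<in>I. c i * f i x) has_derivative 
     (\<lambda>v. \<Sum>i\<in>I. c i * partial_deriv v (f i) x)) (at x)"
    by (auto intro!: derivative_eq_intros harmonic_differentiable assms)
qed

lemma partial_deriv_euclidean:
  fixes f :: "'a::euclidean_space \<Rightarrow> complex"
  assumes "harmonic_on UNIV f"
  shows "partial_deriv v f x = (\<Sum>b\<in>Basis. of_real (v \<bullet> b) * partial_deriv b f x)"
proof (rule harmonicE[OF assms])
  fix f' :: "'a \<Rightarrow> 'a \<Rightarrow>\<^sub>L complex"
  assume *: "\<And>v x. partial_deriv v f x = f' x v"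
  have "f' x v = f' x (\<Sum>b\<in>Basis. (v \<bullet> b) *\<^sub>R b)" by (simp add: euclidean_representation)
  also have "\<dots> = (\<Sum>b\<in>Basis. (v \<bullet> b) *\<^sub>R f' x b)" by (simp add: blinfun.sum_right blinfun.scaleR_right)
  finally show ?thesis by (simp add: * scaleR_conv_of_real)
qed

section \<open>Weighted averages\<close>

abbreviation average_box :: "'a::euclidean_space set" where
  "average_box \<equiv> cbox (- (2 *\<^sub>R One)) (2 *\<^sub>R One)"

lemma norm_ge_2_outside_average_box:
  assumes "x \<notin> average_box" shows "norm x \<ge> 2"
proof (rule ccontr)
  assume "\<not> norm x \<ge> 2"
  then have "\<bar>x \<bullet> b\<bar> \<le> 2" if "b \<in> Basis" for b
    using Basis_le_norm[OF that, of x] by linarith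
  with assms show False by (auto simp: mem_box abs_le_iff minus_le_iff)
qed

text \<open>
  A function supported in the unit ball is still supported in the box of half-side 2 after a
  translation by at most 1, so its integral over this fixed box does not see the translation.
\<close>

lemma integral_translate_supported:
  fixes F :: "'a::euclidean_space \<Rightarrow> complex"
  assumes cont: "continuous_on UNIV F" and supp: "\<And>x. norm x \<ge> 1 \<Longrightarrow> F x = 0" and c: "norm c \<le> 1"
  shows "integral average_box (\<lambda>x. F (x + c)) = integral average_box F"
proof -
  let ?Q = "average_box :: 'a set"
  have 1: "(F has_integral integral ?Q F) ?Q"
    by (intro integrable_integral integrable_continuous continuous_on_subset[OF cont]) auto
  from has_integral_affinity'[OF 1, of 1 c]
  have "((\<lambda>x. F (x + c)) has_integral integral ?Q F) (cbox (- (2 *\<^sub>R One) - c) (2 *\<^sub>R One - c))"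
    by simp
  moreover have "F (x + c) = 0" if "x \<notin> cbox (- (2 *\<^sub>R One) - c) (2 *\<^sub>R One - c)" for x
  proof -
    have "x + c \<notin> ?Q" using that by (auto simp: mem_box inner_simps algebra_simps)
    from norm_ge_2_outside_average_box[OF this] show ?thesis by (intro supp) auto
  qed
  ultimately have a: "((\<lambda>x. F (x + c)) has_integral integral ?Q F) UNIV"
    by (rule has_integral_on_superset) auto
  have "((\<lambda>x. F (x + c)) has_integral integral ?Q (\<lambda>x. F (x + c))) ?Q"
    by (intro integrable_integral integrable_continuous continuous_on_compose2[OF cont] continuous_intros) auto
  moreover have "F (x + c) = 0" if "x \<notin> ?Q" for x
    using norm_ge_2_outside_average_box[OF that] norm_triangle_ineq2[of x "-c"] c by (intro supp) auto
  ultimately have b: "((\<lambda>x. F (x + c)) has_integral integral ?Q (\<lambda>x. F (x + c))) UNIV"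
    by (rule has_integral_on_superset) auto
  show ?thesis using has_integral_unique[OF a b] by simp
qed

text \<open>
  The integral of a compactly supported function does not change under translations along \<open>v\<close>;
  differentiating the translated integral in the translation parameter gives the claim,
  the case of the divergence theorem that is used below.
\<close>

lemma integral_derivative_supported:
  fixes F :: "'a::euclidean_space \<Rightarrow> complex"
  assumes der: "\<And>x. (F has_derivative F' x) (at x)" and cont: "continuous_on UNIV (\<lambda>x. F' x v)"
    and supp: "\<And>x. norm x \<ge> 1 \<Longrightarrow> F x = 0" and v: "norm v \<le> 1"
  shows "integral average_box (\<lambda>x. F' x v) = 0"
proof -
  let ?U = "{-1<..<1::real}"
  have cF: "continuous_on UNIV F"
    by (meson der continuous_at_imp_continuous_on has_derivative_continuous)
  have d: "((\<lambda>s. F (x + s *\<^sub>R v)) has_vector_derivative F' (x + s *\<^sub>R v) v) (at s)" for x s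
  proof -
    have "((\<lambda>s. F (x + s *\<^sub>R v)) has_derivative (\<lambda>h. F' (x + s *\<^sub>R v) (h *\<^sub>R v))) (at s)"
      by (rule has_derivative_compose[OF _ der]) (auto intro!: derivative_eq_intros)
    moreover have "F' (x + s *\<^sub>R v) (h *\<^sub>R v) = h *\<^sub>R F' (x + s *\<^sub>R v) v" for h
      by (rule linear_scale[OF bounded_linear.linear[OF has_derivative_bounded_linear[OF der]]])
    ultimately show ?thesis
      by (simp add: has_vector_derivative_def)
  qed
  have i: "(\<lambda>x. F (x + s *\<^sub>R v)) integrable_on average_box" for s
    by (intro integrable_continuous continuous_on_compose2[OF cF] continuous_intros) auto
  have c: "continuous_on (?U \<times> average_box) (\<lambda>(s, x). F' (x + s *\<^sub>R v) v)"
    unfolding case_prod_unfold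
    by (intro continuous_on_compose2[OF cont] continuous_intros) auto
  have "((\<lambda>s. integral average_box (\<lambda>x. F (x + s *\<^sub>R v))) has_vector_derivative 
      integral average_box (\<lambda>x. F' (x + 0 *\<^sub>R v) v)) (at 0 within ?U)"
    by (rule leibniz_rule_vector_derivative[OF has_vector_derivative_at_within[OF d] i c]) auto
  then have 1: "((\<lambda>s. integral average_box (\<lambda>x. F (x + s *\<^sub>R v))) has_vector_derivative 
      integral average_box (\<lambda>x. F' x v)) (at 0)"
    by (simp add: at_within_open[of 0 ?U])
  have "((\<lambda>s::real. integral average_box F) has_vector_derivative 0) (at 0)" by simp
  then have 2: "((\<lambda>s. integral average_box (\<lambda>x. F (x + s *\<^sub>R v))) has_vector_derivative 0) (at 0)"
  proof (rule has_vector_derivative_transform_within_open[where S = ?U])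
    fix s assume "s \<in> ?U"
    then have "norm (s *\<^sub>R v) \<le> 1" using v mult_le_one[of "\<bar>s\<bar>" "norm v"] by auto
    from integral_translate_supported[OF cF supp this] 
    show "integral average_box F = integral average_box (\<lambda>x. F (x + s *\<^sub>R v))" by simp
  qed auto
  show ?thesis using vector_derivative_unique_at[OF 1 2] .
qed

lemma integral_by_parts_supported:
  fixes f :: "'a::euclidean_space \<Rightarrow> complex" and k :: "'a \<Rightarrow> real"
  assumes k: "\<And>x. (k has_derivative k' x) (at x)" and ck: "continuous_on UNIV (\<lambda>x. k' x v)"
    and f: "\<And>x. (f has_derivative f' x) (at x)" and cf: "continuous_on UNIV (\<lambda>x. f' x v)"
    and supp: "\<And>x. norm x \<ge> 1 \<Longrightarrow> k x = 0" and v: "norm v \<le> 1"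
  shows "integral average_box (\<lambda>x. k' x v *\<^sub>R f x) = - integral average_box (\<lambda>x. k x *\<^sub>R f' x v)"
proof -
  have c: "continuous_on A k" "continuous_on A f" for A
    using k f by (meson continuous_at_imp_continuous_on has_derivative_continuous)+
  have cc: "continuous_on A (\<lambda>x. k' x v)" "continuous_on A (\<lambda>x. f' x v)" for A
    using ck cf continuous_on_subset by blast+
  have "integral average_box (\<lambda>x. k x *\<^sub>R f' x v + k' x v *\<^sub>R f x) = 0"
    by (rule integral_derivative_supported[where F = "\<lambda>x. k x *\<^sub>R f x"])
      (auto intro!: derivative_eq_intros k f continuous_intros c cc supp v)
  moreover have "integral average_box (\<lambda>x. k x *\<^sub>R f' x v + k' x v *\<^sub>R f x) = 
     integral average_box (\<lambda>x. k x *\<^sub>R f' x v) + integral average_box (\<lambda>x. k' x v *\<^sub>R f x)"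
    by (intro integral_add integrable_continuous continuous_intros c cc)
  ultimately show ?thesis by (simp add: eq_neg_iff_add_eq_0 add.commute)
qed

text \<open>
  For a kernel supported in the unit ball this is, up to normalization and reflection, the convolution of \<open>f\<close> with
  the kernel rescaled to radius \<open>R\<close>. Keeping the kernel fixed and scaling the argument of \<open>f\<close> makes
  the domain of integration independent of \<open>x\<close> and \<open>R\<close>.
\<close>

definition average :: "('a::euclidean_space \<Rightarrow> real) \<Rightarrow> real \<Rightarrow> ('a \<Rightarrow> 'c::banach) \<Rightarrow> 'a \<Rightarrow> 'c" where
  "average k R f x = integral average_box (\<lambda>z. k z *\<^sub>R f (x + R *\<^sub>R z))"

lemma has_derivative_average:
  fixes f :: "'a::euclidean_space \<Rightarrow> 'c::banach"
  assumes k: "continuous_on UNIV k" and f: "\<And>x. (f has_derivative blinfun_apply (f' x)) (at x)" 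
    and f': "continuous_on UNIV f'"
  shows "(average k R f has_derivative blinfun_apply (average k R f' x)) (at x)"
proof -
  have cf: "continuous_on UNIV f"
    using f by (meson continuous_at_imp_continuous_on has_derivative_continuous)
  have ck: "continuous_on A k" for A using k continuous_on_subset by blast
  have d: "((\<lambda>x. k z *\<^sub>R f (x + R *\<^sub>R z)) has_derivative blinfun_apply (k z *\<^sub>R f' (x + R *\<^sub>R z))) (at x)" for x z
  proof -
    have "((\<lambda>x. f (x + R *\<^sub>R z)) has_derivative (\<lambda>h. f' (x + R *\<^sub>R z) h)) (at x)"
      by (rule has_derivative_compose[OF _ f]) (auto intro!: derivative_eq_intros)
    from has_derivative_scaleR_right[OF this, of "k z"] show ?thesis by (simp add: scaleR_blinfun.rep_eq)
  qed
  have i: "(\<lambda>z. k z *\<^sub>R f (x + R *\<^sub>R z)) integrable_on average_box" for x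
    by (intro integrable_continuous continuous_on_scaleR ck continuous_on_compose2[OF cf] continuous_intros) auto
  have c: "continuous_on (UNIV \<times> average_box) (\<lambda>(x, z). k z *\<^sub>R f' (x + R *\<^sub>R z))"
    unfolding case_prod_unfold
    by (intro continuous_on_scaleR continuous_on_compose2[OF k] continuous_on_compose2[OF f'] continuous_intros) auto
  have "((\<lambda>x. integral average_box (\<lambda>z. k z *\<^sub>R f (x + R *\<^sub>R z))) has_derivative 
     blinfun_apply (integral average_box (\<lambda>z. k z *\<^sub>R f' (x + R *\<^sub>R z)))) (at x within UNIV)"
    by (rule leibniz_rule[OF _ i c]) (use d in auto)
  then show ?thesis by (simp add: average_def[abs_def])
qed

lemma continuous_average:
  fixes f :: "'a::euclidean_space \<Rightarrow> 'c::banach"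
  assumes k: "continuous_on UNIV k" and f: "continuous_on UNIV f"
  shows "continuous_on UNIV (average k R f)"
  unfolding average_def[abs_def]
  by (rule integral_continuous_on_param, unfold case_prod_unfold,
      intro continuous_on_scaleR continuous_on_compose2[OF k] continuous_on_compose2[OF f] continuous_intros) auto

lemma bounded_linear_average:
  fixes f :: "'a::euclidean_space \<Rightarrow> 'c::banach"
  assumes k: "continuous_on UNIV k" and f: "continuous_on UNIV f" and h: "bounded_linear h"
  shows "h (average k R f x) = average k R (\<lambda>y. h (f y)) x"
proof -
  have "(\<lambda>z. k z *\<^sub>R f (x + R *\<^sub>R z)) integrable_on average_box"
    by (intro integrable_continuous continuous_on_scaleR continuous_on_compose2[OF k] 
        continuous_on_compose2[OF f] continuous_intros) auto
  from integral_linear[OF this h] show ?thesis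
    unfolding average_def by (simp add: o_def linear_simps[OF h])
qed

lemma harmonic_average:
  fixes f :: "'a::euclidean_space \<Rightarrow> complex"
  assumes k: "continuous_on UNIV k" and f: "harmonic_on UNIV f"
  shows "harmonic_on UNIV (average k R f)"
proof (rule harmonicE[OF f])
  fix f' f''
  assume f: "\<And>x. (f has_derivative blinfun_apply (f' x)) (at x)" "\<And>x. (f' has_derivative blinfun_apply (f'' x)) (at x)"
    "continuous_on UNIV f''" "\<And>x. (\<Sum>b\<in>Basis. f'' x b b) = 0"
  have cf': "continuous_on UNIV f'"
    using f(2) by (meson continuous_at_imp_continuous_on has_derivative_continuous)
  show ?thesis
  proof (rule harmonicI[where f' = "average k R f'" and f'' = "average k R f''"])
    have h: "bounded_linear (\<lambda>A :: 'a \<Rightarrow>\<^sub>L 'a \<Rightarrow>\<^sub>L complex. \<Sum>b\<in>Basis. A b b)"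
      by (intro bounded_linear_intros bounded_linear_sum)
    show "(\<Sum>b\<in>Basis. average k R f'' x b b) = 0" for x
      using bounded_linear_average[OF k f(3) h, of R x] by (simp add: f(4) average_def)
  qed (intro has_derivative_average k f cf' continuous_average)+
qed

section \<open>The mean value property and the gradient estimate\<close>

text \<open>
  The truncated powers are continuously differentiable across 0. The square is the lowest power
  for which this holds; it makes the kernel below once, and its radial primitive twice,
  continuously differentiable.
\<close>

lemma has_derivative_max_power2:
  "((\<lambda>s::real. (max 0 s)\<^sup>2) has_field_derivative 2 * max 0 s) (at s)"
proof -
  consider "s < 0" | "s = 0" | "s > 0" by linarith
  then show ?thesis
  proof cases
    case 1
    have "((\<lambda>s::real. 0) has_field_derivative 2 * max 0 s) (at s)" using 1 by simp
    then show ?thesis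
      by (rule has_field_derivative_transform_within_open[where S = "{..<0}"]) (use 1 in auto)
  next
    case 2
    have "isCont (\<lambda>z::real. max 0 z) 0" by (intro continuous_intros)
    then show ?thesis unfolding CARAT_DERIV 2
      by (intro exI[of _ "\<lambda>z. max 0 z"]) (auto simp: max_def power2_eq_square)
  next
    case 3
    have "((\<lambda>s::real. s\<^sup>2) has_field_derivative 2 * max 0 s) (at s)" 
      using 3 by (auto intro!: derivative_eq_intros)
    then show ?thesis
      by (rule has_field_derivative_transform_within_open[where S = "{0<..}"]) (use 3 in auto)
  qed
qed

lemma has_derivative_max_power3:
  "((\<lambda>s::real. (max 0 s) ^ 3) has_field_derivative 3 * (max 0 s)\<^sup>2) (at s)"
proof -
  have "((\<lambda>s::real. s * (max 0 s)\<^sup>2) has_field_derivative 1 * (max 0 s)\<^sup>2 + 2 * max 0 s * s) (at s)"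
    by (intro DERIV_mult DERIV_ident has_derivative_max_power2)
  moreover have "(\<lambda>s::real. s * (max 0 s)\<^sup>2) = (\<lambda>s. (max 0 s) ^ 3)"
    by (auto simp: max_def power2_eq_square power3_eq_cube)
  moreover have "1 * (max 0 s)\<^sup>2 + 2 * max 0 s * s = 3 * (max 0 s)\<^sup>2"
    by (auto simp: max_def power2_eq_square)
  ultimately show ?thesis by metis
qed

text \<open>
  The kernel \<open>(1 - |z|\<^sup>2)\<^sup>2\<close>, cut off outside the unit ball. It is radial, and \<open>z\<close> times the kernel is
  explicitly a gradient, which is what the mean value property needs.
\<close>

definition bump :: "'a::euclidean_space \<Rightarrow> real" where
  "bump z = (max 0 (1 - z \<bullet> z))\<^sup>2"

lemma has_derivative_bump:
  "(bump has_derivative (\<lambda>v. -4 * max 0 (1 - z \<bullet> z) * (z \<bullet> v))) (at z)"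
proof -
  have "((\<lambda>z. 1 - z \<bullet> z) has_derivative (\<lambda>v. - 2 * (z \<bullet> v))) (at z)"
    by (auto intro!: derivative_eq_intros simp: inner_commute)
  from has_derivative_compose[OF this has_derivative_max_power2[of "1 - z \<bullet> z", unfolded has_field_derivative_def]]
  show ?thesis unfolding bump_def[abs_def] by (simp add: mult_ac)
qed

text \<open>
  In other words \<open>z\<close> times \<open>bump z\<close> is \<open>-1/6\<close> times the gradient of \<open>(1 - |z|\<^sup>2)\<^sup>3\<close>.
\<close>

lemma has_derivative_bump_primitive:
  "((\<lambda>z. (max 0 (1 - z \<bullet> z)) ^ 3) has_derivative (\<lambda>v. -6 * bump z * (z \<bullet> v))) (at z)"
proof -
  have "((\<lambda>z. 1 - z \<bullet> z) has_derivative (\<lambda>v. - 2 * (z \<bullet> v))) (at z)"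
    by (auto intro!: derivative_eq_intros simp: inner_commute)
  from has_derivative_compose[OF this has_derivative_max_power3[of "1 - z \<bullet> z", unfolded has_field_derivative_def]]
  show ?thesis unfolding bump_def by (simp add: mult_ac)
qed

lemma continuous_bump: "continuous_on A bump"
  unfolding bump_def[abs_def] by (intro continuous_intros)

lemma bump_outside:
  fixes z :: "'a::euclidean_space"
  assumes "norm z \<ge> 1" shows "max 0 (1 - z \<bullet> z) = 0"
  using assms power_mono[of 1 "norm z" 2] by (simp add: dot_square_norm)

definition bump_mass :: "'a::euclidean_space itself \<Rightarrow> real" where
  "bump_mass _ = integral average_box (bump :: 'a \<Rightarrow> real)"

lemma bump_mass_pos: "bump_mass TYPE('a::euclidean_space) > 0"
proof -
  let ?I = "integral average_box (bump :: 'a \<Rightarrow> real)"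
  have "?I \<ge> 0" by (rule integral_nonneg) (auto simp: bump_def intro!: integrable_continuous continuous_intros)
  moreover have "?I \<noteq> 0"
  proof
    assume "?I = 0"
    moreover have "box (- (2 *\<^sub>R One)) (2 *\<^sub>R One) \<noteq> ({} :: 'a set)"
      by (auto simp: box_ne_empty)
    ultimately have "\<forall>x\<in>average_box. bump (x::'a) = 0"
      using integral_cbox_eq_0_iff[OF continuous_bump[where A = "average_box :: 'a set"]]
      by (auto simp: bump_def)
    moreover have "(0::'a) \<in> average_box" by (auto simp: mem_box)
    ultimately have "bump (0::'a) = 0" by blast
    then show False by (simp add: bump_def)
  qed
  ultimately show ?thesis by (simp add: bump_mass_def)
qed

text \<open>
  The mean value property, with a smooth radial kernel instead of spheres. The derivative of the
  average in \<open>R\<close> is the integral of \<open>bump z\<close> times the derivative of \<open>f\<close> in direction \<open>z\<close>. Since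
  \<open>bump z\<close> times \<open>z\<close> is a gradient, an integration by parts turns this into an integral of the
  Laplacian of \<open>f\<close>, which vanishes. Hence the average is the same for all \<open>R\<close>, and for \<open>R = 0\<close> it
  is \<open>f x\<close> times the mass of the kernel.
\<close>

lemma harmonic_average_radius:
  fixes f :: "'a::euclidean_space \<Rightarrow> complex"
  assumes "harmonic_on UNIV f"
  shows "average bump R f x = bump_mass TYPE('a) *\<^sub>R f x"
proof (rule harmonicE[OF assms])
  fix f' f''
  assume f: "\<And>x. (f has_derivative blinfun_apply (f' x)) (at x)" "\<And>x. (f' has_derivative blinfun_apply (f'' x)) (at x)"
    and cf'': "continuous_on UNIV f''" and lap: "\<And>x. (\<Sum>b\<in>Basis. f'' x b b) = 0"
  have cf: "continuous_on UNIV f" and cf': "continuous_on UNIV f'"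
    using f by (meson continuous_at_imp_continuous_on has_derivative_continuous)+
  \<comment> \<open>The compactly supported radial function whose gradient is \<open>-6\<close> times \<open>z\<close> times the kernel.\<close>
  define \<psi> :: "'a \<Rightarrow> real" where "\<psi> z = (max 0 (1 - z \<bullet> z)) ^ 3" for z
  have c\<psi>: "continuous_on A \<psi>" for A unfolding \<psi>_def[abs_def] by (intro continuous_intros)
  have d: "((\<lambda>r. bump z *\<^sub>R f (x + r *\<^sub>R z)) has_vector_derivative bump z *\<^sub>R f' (x + r *\<^sub>R z) z) (at r)" for z r
  proof -
    have "((\<lambda>r. f (x + r *\<^sub>R z)) has_derivative (\<lambda>h. f' (x + r *\<^sub>R z) (h *\<^sub>R z))) (at r)"
      by (rule has_derivative_compose[OF _ f(1)]) (auto intro!: derivative_eq_intros)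
    from has_derivative_scaleR_right[OF this, of "bump z"]
    show ?thesis by (simp add: has_vector_derivative_def blinfun.scaleR_right mult.commute)
  qed
  have i: "(\<lambda>z. bump z *\<^sub>R f (x + r *\<^sub>R z)) integrable_on average_box" for r
    by (intro integrable_continuous continuous_on_scaleR continuous_bump continuous_on_compose2[OF cf] continuous_intros) auto
  have c: "continuous_on (UNIV \<times> average_box) (\<lambda>(r, z). bump z *\<^sub>R f' (x + r *\<^sub>R z) z)"
    unfolding case_prod_unfold
    by (intro continuous_on_scaleR continuous_on_compose2[OF continuous_bump[where A = UNIV]]
          blinfun.continuous_on continuous_on_compose2[OF cf'] continuous_intros) auto
  have zero: "integral average_box (\<lambda>z. bump z *\<^sub>R f' (x + r *\<^sub>R z) z) = 0" for r
  proof -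
    have ibp: "integral average_box (\<lambda>z. (- 6 * bump z * (z \<bullet> b)) *\<^sub>R f' (x + r *\<^sub>R z) b) =
       - integral average_box (\<lambda>z. \<psi> z *\<^sub>R (r *\<^sub>R f'' (x + r *\<^sub>R z) b b))" if b: "b \<in> Basis" for b
    proof (rule integral_by_parts_supported[where v = b and k' = "\<lambda>z v. - 6 * bump z * (z \<bullet> v)"
          and f' = "\<lambda>z v. r *\<^sub>R f'' (x + r *\<^sub>R z) v b"])
      show "(\<psi> has_derivative (\<lambda>v. - 6 * bump z * (z \<bullet> v))) (at z)" for z
        unfolding \<psi>_def[abs_def] by (rule has_derivative_bump_primitive)
      show "((\<lambda>z. f' (x + r *\<^sub>R z) b) has_derivative (\<lambda>v. r *\<^sub>R f'' (x + r *\<^sub>R z) v b)) (at z)" for z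
      proof -
        have "((\<lambda>z. f' (x + r *\<^sub>R z)) has_derivative (\<lambda>v. f'' (x + r *\<^sub>R z) (r *\<^sub>R v))) (at z)"
          by (rule has_derivative_compose[OF _ f(2)]) (auto intro!: derivative_eq_intros)
        from bounded_linear.has_derivative[OF blinfun.bounded_linear_left[of b] this]
        show ?thesis by (simp add: blinfun.scaleR_right blinfun.scaleR_left)
      qed
      show "continuous_on UNIV (\<lambda>z::'a. - 6 * bump z * (z \<bullet> b))"
        by (intro continuous_intros continuous_bump)
      show "continuous_on UNIV (\<lambda>z. r *\<^sub>R f'' (x + r *\<^sub>R z) b b)"
        by (intro continuous_on_scaleR blinfun.continuous_on continuous_on_compose2[OF cf''] continuous_intros) auto
      show "\<psi> z = 0" if "norm z \<ge> 1" for z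
        using bump_outside[OF that] by (simp add: \<psi>_def)
    qed (use b in auto)
    have "integral average_box (\<lambda>z. bump z *\<^sub>R f' (x + r *\<^sub>R z) z) = 
       integral average_box (\<lambda>z. \<Sum>b\<in>Basis. (-1/6) *\<^sub>R ((- 6 * bump z * (z \<bullet> b)) *\<^sub>R f' (x + r *\<^sub>R z) b))"
    proof (rule integral_cong)
      fix z :: 'a
      have "f' (x + r *\<^sub>R z) z = f' (x + r *\<^sub>R z) (\<Sum>b\<in>Basis. (z \<bullet> b) *\<^sub>R b)"
        by (simp add: euclidean_representation)
      then show "bump z *\<^sub>R f' (x + r *\<^sub>R z) z =
        (\<Sum>b\<in>Basis. (-1/6) *\<^sub>R ((- 6 * bump z * (z \<bullet> b)) *\<^sub>R f' (x + r *\<^sub>R z) b))"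
        by (simp add: blinfun.sum_right blinfun.scaleR_right scaleR_sum_right)
    qed
    also have "\<dots> = (\<Sum>b\<in>Basis. integral average_box
         (\<lambda>z. (-1/6) *\<^sub>R ((- 6 * bump z * (z \<bullet> b)) *\<^sub>R f' (x + r *\<^sub>R z) b)))"
      by (intro integral_sum integrable_continuous continuous_on_scaleR continuous_on_mult continuous_bump
          blinfun.continuous_on continuous_on_compose2[OF cf'] continuous_intros) auto
    also have "\<dots> = (\<Sum>b\<in>Basis. (1/6) *\<^sub>R integral average_box (\<lambda>z. \<psi> z *\<^sub>R (r *\<^sub>R f'' (x + r *\<^sub>R z) b b)))"
      by (intro sum.cong refl) (subst integral_cmul, simp only: ibp, simp)
    also have "\<dots> = (1/6) *\<^sub>R (\<Sum>b\<in>Basis. integral average_box (\<lambda>z. \<psi> z *\<^sub>R (r *\<^sub>R f'' (x + r *\<^sub>R z) b b)))"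
      by (simp only: scaleR_sum_right)
    also have "(\<Sum>b\<in>Basis. integral average_box (\<lambda>z. \<psi> z *\<^sub>R (r *\<^sub>R f'' (x + r *\<^sub>R z) b b))) = 
       integral average_box (\<lambda>z. \<Sum>b\<in>Basis. \<psi> z *\<^sub>R (r *\<^sub>R f'' (x + r *\<^sub>R z) b b))"
      by (intro integral_sum[symmetric] integrable_continuous continuous_on_scaleR c\<psi>
          blinfun.continuous_on continuous_on_compose2[OF cf''] continuous_intros) auto
    also have "\<dots> = 0" by (simp add: lap flip: scaleR_sum_right)
    finally show ?thesis by simp
  qed
  have "((\<lambda>r. average bump r f x) has_vector_derivative 0) (at r within UNIV)" for r
    unfolding average_def zero[of r, symmetric]
    by (rule leibniz_rule_vector_derivative[OF has_vector_derivative_at_within[OF d] i c]) auto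
  then obtain k where "\<And>r. average bump r f x = k"
    using has_vector_derivative_zero_constant[of UNIV "\<lambda>r. average bump r f x"] by auto
  then have "average bump R f x = average bump 0 f x" by simp
  also have "\<dots> = integral average_box (\<lambda>z. bump (z::'a) *\<^sub>R f x)" by (simp add: average_def)
  also have "\<dots> = bump_mass TYPE('a) *\<^sub>R f x" unfolding bump_mass_def
    by (rule integral_unique[OF has_integral_scaleR_left[OF integrable_integral]])
      (intro integrable_continuous continuous_bump)
  finally show ?thesis .
qed

text \<open>
  Differentiating the mean value property in \<open>x\<close> and integrating by parts moves the derivative from
  \<open>f\<close> to the kernel. The right-hand side contains no derivative of \<open>f\<close>: this gives both the
  regularity of the derivative and a bound for it.
\<close>

lemma partial_deriv_eq_average:
  fixes f :: "'a::euclidean_space \<Rightarrow> complex"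
  assumes "harmonic_on UNIV f" "R \<noteq> 0" "norm v \<le> 1"
  shows "partial_deriv v f x = 
    average (\<lambda>z. 4 / (R * bump_mass TYPE('a)) * (max 0 (1 - z \<bullet> z) * (z \<bullet> v))) R f x"
proof (rule harmonicE[OF assms(1)])
  fix f' f''
  assume f: "\<And>x. (f has_derivative blinfun_apply (f' x)) (at x)" "\<And>x. (f' has_derivative blinfun_apply (f'' x)) (at x)"
    and pd: "\<And>v x. partial_deriv v f x = f' x v"
  have cf': "continuous_on UNIV f'"
    using f by (meson continuous_at_imp_continuous_on has_derivative_continuous)
  let ?c = "bump_mass TYPE('a)"
  have c: "?c > 0" by (rule bump_mass_pos)
  let ?k = "\<lambda>z. -4 * max 0 (1 - z \<bullet> z) * (z \<bullet> v)"
  have "(average bump R f has_derivative blinfun_apply (average bump R f' x)) (at x)"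
    by (rule has_derivative_average[OF continuous_bump f(1) cf'])
  from partial_deriv_eq[OF this, of v]
  have "partial_deriv v (average bump R f) x = average bump R f' x v" .
  moreover have "partial_deriv v (average bump R f) x = ?c *\<^sub>R f' x v"
  proof (rule partial_deriv_eq)
    show "(average bump R f has_derivative (\<lambda>v. ?c *\<^sub>R f' x v)) (at x)"
      unfolding harmonic_average_radius[OF assms(1), abs_def]
      by (intro has_derivative_scaleR_right f)
  qed
  ultimately have "?c *\<^sub>R f' x v = average bump R f' x v" by simp
  also have "\<dots> = average bump R (\<lambda>x. f' x v) x"
    by (rule bounded_linear_average[OF continuous_bump cf']) auto
  finally have 1: "?c *\<^sub>R f' x v = average bump R (\<lambda>x. f' x v) x" .
  have "integral average_box (\<lambda>z. ?k z *\<^sub>R f (x + R *\<^sub>R z)) = 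
    - integral average_box (\<lambda>z. bump z *\<^sub>R (R *\<^sub>R f' (x + R *\<^sub>R z) v))"
  proof (rule integral_by_parts_supported[OF has_derivative_bump, where f' = "\<lambda>z v. R *\<^sub>R f' (x + R *\<^sub>R z) v"])
    show "((\<lambda>z. f (x + R *\<^sub>R z)) has_derivative (\<lambda>v. R *\<^sub>R f' (x + R *\<^sub>R z) v)) (at z)" for z
    proof -
      have "((\<lambda>z. f (x + R *\<^sub>R z)) has_derivative (\<lambda>v. f' (x + R *\<^sub>R z) (R *\<^sub>R v))) (at z)"
        by (rule has_derivative_compose[OF _ f(1)]) (auto intro!: derivative_eq_intros)
      then show ?thesis by (simp add: blinfun.scaleR_right)
    qed
    show "bump z = 0" if "norm z \<ge> 1" for z :: 'a
      using bump_outside[OF that] by (simp add: bump_def)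
    show "continuous_on UNIV (\<lambda>z. R *\<^sub>R f' (x + R *\<^sub>R z) v)"
      by (intro continuous_on_scaleR blinfun.continuous_on continuous_on_compose2[OF cf'] continuous_intros) auto
    show "continuous_on UNIV ?k" by (intro continuous_intros)
  qed (rule assms)
  also have "\<dots> = - R *\<^sub>R average bump R (\<lambda>x. f' x v) x"
    unfolding average_def scaleR_left_commute[of _ R] integral_cmul by simp
  finally have 2: "integral average_box (\<lambda>z. ?k z *\<^sub>R f (x + R *\<^sub>R z)) = - R *\<^sub>R (?c *\<^sub>R f' x v)"
    by (simp add: 1)
  have "average (\<lambda>z. 4 / (R * ?c) * (max 0 (1 - z \<bullet> z) * (z \<bullet> v))) R f x =
    integral average_box (\<lambda>z. (-1 / (R * ?c)) *\<^sub>R (?k z *\<^sub>R f (x + R *\<^sub>R z)))"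
    unfolding average_def by (intro integral_cong) (simp add: mult_ac)
  also have "\<dots> = (-1 / (R * ?c)) *\<^sub>R (- R *\<^sub>R (?c *\<^sub>R f' x v))"
    unfolding integral_cmul 2 ..
  also have "\<dots> = f' x v" using c assms(2) by simp
  finally show ?thesis by (simp add: pd)
qed

text \<open>
  A derivative of a harmonic function is an average of it, and averages inherit two continuous
  derivatives and the vanishing Laplacian from \<open>f\<close> itself. Iterated, this makes harmonic functions
  smooth.
\<close>

lemma harmonic_partial_deriv:
  fixes f :: "'a::euclidean_space \<Rightarrow> complex"
  assumes "harmonic_on UNIV f"
  shows "harmonic_on UNIV (partial_deriv v f)"
proof -
  have "harmonic_on UNIV (partial_deriv b f)" if "b \<in> Basis" for b
  proof -
    have eq: "partial_deriv b f = average (\<lambda>z. 4 / (1 * bump_mass TYPE('a)) * (max 0 (1 - z \<bullet> z) * (z \<bullet> b))) 1 f"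
      using partial_deriv_eq_average[OF assms, of 1 b] that by auto
    show ?thesis unfolding eq
      by (intro harmonic_average assms continuous_intros)
  qed
  then have "harmonic_on UNIV (\<lambda>x. \<Sum>b\<in>Basis. of_real (v \<bullet> b) * partial_deriv b f x)"
    by (intro harmonic_sum harmonic_mult)
  then show ?thesis using partial_deriv_euclidean[OF assms, of v] by presburger
qed

text \<open>
  The summand 1 only serves to make the constant at least 1.
\<close>

definition gradient_const :: "'a::euclidean_space itself \<Rightarrow> real" where
  "gradient_const _ = 1 + 4 * measure lborel (average_box :: 'a set) / bump_mass TYPE('a)"

lemma gradient_const_ge_1: "gradient_const TYPE('a::euclidean_space) \<ge> 1"
  unfolding gradient_const_def using bump_mass_pos[where 'a='a] 
  by (metis add_increasing2 divide_nonneg_pos measure_nonneg mult_nonneg_nonneg order_refl zero_le_numeral)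

text \<open>
  The Cauchy estimate for harmonic functions. The factor \<open>1 / R\<close> is decisive: since \<open>R\<close> is arbitrary
  for entire functions, derivatives of high order come out small.
\<close>

lemma gradient_estimate:
  fixes f :: "'a::euclidean_space \<Rightarrow> complex"
  assumes "harmonic_on UNIV f" "R > 0" and B: "\<And>y. y \<in> cball x R \<Longrightarrow> norm (f y) \<le> B"
  shows "norm (partial_deriv v f x) \<le> gradient_const TYPE('a) * norm v / R * B"
proof -
  let ?c = "bump_mass TYPE('a)"
  have c: "?c > 0" by (rule bump_mass_pos)
  have B0: "B \<ge> 0" using B[of x] norm_ge_zero[of "f x"] assms(2) by (simp del: norm_ge_zero)
  define u where "u = sgn v"
  have nu: "norm u \<le> 1" by (simp add: u_def norm_sgn)
  have v: "v = norm v *\<^sub>R u" by (cases "v = 0") (simp_all add: u_def sgn_div_norm)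
  let ?k = "\<lambda>z::'a. 4 / (R * ?c) * (max 0 (1 - z \<bullet> z) * (z \<bullet> u))"
  have bd: "norm (?k z *\<^sub>R f (x + R *\<^sub>R z)) \<le> 4 / (R * ?c) * B" for z
  proof (cases "norm z \<ge> 1")
    case True
    then show ?thesis using bump_outside[OF True] B0 c assms(2) by simp
  next
    case False
    have "norm (f (x + R *\<^sub>R z)) \<le> B" using False assms(2) by (intro B) (auto simp: dist_norm)
    moreover have "\<bar>z \<bullet> u\<bar> \<le> 1 * 1"
      by (rule order_trans[OF Cauchy_Schwarz_ineq2]) (use False nu in \<open>intro mult_mono, auto\<close>)
    then have "\<bar>max 0 (1 - z \<bullet> z) * (z \<bullet> u)\<bar> \<le> 1 * 1"
      unfolding abs_mult by (intro mult_mono) auto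
    then have "\<bar>?k z\<bar> \<le> 4 / (R * ?c) * 1"
      unfolding abs_mult[of "4 / (R * ?c)"] using c assms(2) by (intro mult_mono) auto
    ultimately show ?thesis unfolding norm_scaleR using c assms(2)
      by (intro mult_mono) auto
  qed
  have cont: "continuous_on average_box (\<lambda>z. ?k z *\<^sub>R f (x + R *\<^sub>R z))"
    by (intro continuous_on_scaleR continuous_on_compose2[OF harmonic_continuous[OF assms(1), of UNIV]] continuous_intros) auto
  have "norm (average ?k R f x) \<le> (4 / (R * ?c) * B) * measure lborel (average_box::'a set)"
    unfolding average_def
    by (rule has_integral_bound[OF _ integrable_integral[OF integrable_continuous[OF cont]]])
       (use bd B0 c assms(2) in auto)
  also have "\<dots> \<le> gradient_const TYPE('a) / R * B"
    using B0 c assms(2) by (simp add: gradient_const_def field_simps)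
  finally have "norm (partial_deriv u f x) \<le> gradient_const TYPE('a) / R * B"
    using partial_deriv_eq_average[OF assms(1) _ nu, of R x] assms(2) by simp
  moreover have "partial_deriv v f x = norm v *\<^sub>R partial_deriv u f x"
  proof (rule harmonicE[OF assms(1)])
    fix f' assume pd: "\<And>v x. partial_deriv v f x = blinfun_apply (f' x) v"
    then show ?thesis by (subst v) (simp add: blinfun.scaleR_right)
  qed
  ultimately have "norm (partial_deriv v f x) \<le> norm v * (gradient_const TYPE('a) / R * B)"
    by (simp only: norm_scaleR abs_norm_cancel) (intro mult_left_mono norm_ge_zero)
  then show ?thesis by (simp add: mult_ac)
qed

section \<open>Taylor series and unique continuation\<close>

lemma power_le_fact_exp:
  fixes x :: real
  assumes "x \<ge> 0" shows "x ^ n \<le> fact n * exp x"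
proof -
  have "(\<Sum>k\<in>{n}. x ^ k /\<^sub>R fact k) \<le> (\<Sum>k. x ^ k /\<^sub>R fact k)"
    using assms by (intro sum_le_suminf summable_exp_generic) auto
  then show ?thesis by (simp add: exp_def field_simps)
qed

lemma harmonic_iterated_partial_deriv:
  fixes f :: "'a::euclidean_space \<Rightarrow> complex"
  assumes "harmonic_on UNIV f"
  shows "harmonic_on UNIV (foldr partial_deriv vs f)"
  by (induction vs) (auto intro: assms harmonic_partial_deriv)

text \<open>
  The estimate for one derivative is applied along a chain of balls of radius \<open>r\<close>, each step using
  up one \<open>r\<close> of the domain. Splitting the available radius into equal steps loses only a factor
  \<open>k\<^sup>k\<close> for \<open>k\<close> derivatives, which is comparable with \<open>k!\<close>.
\<close>

lemma iterated_gradient_estimate: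
  fixes f :: "'a::euclidean_space \<Rightarrow> complex" and r :: real
  assumes f: "harmonic_on UNIV f" and r: "r > 0" and vs: "\<And>v. v \<in> set vs \<Longrightarrow> norm v \<le> V"
    and M: "\<And>y. y \<in> cball x (length vs * r) \<Longrightarrow> norm (f y) \<le> M"
  shows "norm (foldr partial_deriv vs f x) \<le> (gradient_const TYPE('a) * V / r) ^ length vs * M"
  using vs M
proof (induction vs arbitrary: x)
  case Nil
  then show ?case by simp
next
  case (Cons v vs)
  let ?C = "gradient_const TYPE('a)"
  define B where "B = (?C * V / r) ^ length vs * M"
  have C: "?C \<ge> 1" by (rule gradient_const_ge_1)
  have "norm (foldr partial_deriv vs f y) \<le> B" if "y \<in> cball x r" for y
    unfolding B_def
  proof (rule Cons.IH)
    fix z assume "z \<in> cball y (length vs * r)"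
    with that show "norm (f z) \<le> M"
      using dist_triangle[of x z y] by (intro Cons.prems) (auto simp: algebra_simps)
  qed (use Cons.prems in auto)
  then have "norm (partial_deriv v (foldr partial_deriv vs f) x) \<le> ?C * norm v / r * B"
    by (rule gradient_estimate[OF harmonic_iterated_partial_deriv[OF f] r])
  then have "norm (foldr partial_deriv (v # vs) f x) \<le> ?C * norm v / r * B" by simp
  also have "\<dots> \<le> ?C * V / r * B"
  proof -
    have "0 \<le> M" using Cons.prems(2)[of x] r order_trans[OF norm_ge_zero] by fastforce
    moreover have "norm v \<le> V" "0 \<le> V" using Cons.prems(1)[of v] order_trans[OF norm_ge_zero] by auto
    ultimately show ?thesis using C r 
      by (intro mult_right_mono divide_right_mono mult_left_mono) (auto simp: B_def)
  qed
  finally show ?case by (simp add: B_def)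
qed

text \<open>
  Taking balls of radius proportional to \<open>1 / A\<close> gives the factor \<open>A\<^sup>k\<close> with arbitrary \<open>A\<close>: Taylor coefficients of entire
  harmonic functions decay faster than every geometric sequence.
\<close>

lemma iterated_derivatives_bound:
  fixes f :: "'a::euclidean_space \<Rightarrow> complex"
  assumes f: "harmonic_on UNIV f" and A: "A > 0" and V: "V > 0" and \<rho>: "\<rho> \<ge> 0"
  obtains M where "M \<ge> 0"
    "\<And>vs x. \<lbrakk>\<And>v. v \<in> set vs \<Longrightarrow> norm v \<le> V; norm x \<le> \<rho>\<rbrakk> \<Longrightarrow> 
      norm (foldr partial_deriv vs f x) \<le> A ^ length vs * fact (length vs) * M"
proof -
  let ?C = "gradient_const TYPE('a)"
  have C: "?C \<ge> 1" by (rule gradient_const_ge_1)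
  \<comment> \<open>With balls of radius \<open>R / k\<close> the iterated estimate is \<open>(A / e)\<^sup>k k\<^sup>k\<close>, and \<open>k\<^sup>k \<le> k! e\<^sup>k\<close>.\<close>
  define R where "R = ?C * V * exp 1 / A"
  have R: "R > 0" using C V A by (simp add: R_def)
  have "compact (f ` cball 0 (\<rho> + R))"
    by (intro compact_continuous_image harmonic_continuous f) auto
  then obtain M where "\<forall>y \<in> f ` cball 0 (\<rho> + R). norm y \<le> M"
    using compact_imp_bounded bounded_iff by metis
  then have M: "norm (f y) \<le> M" if "norm y \<le> \<rho> + R" for y using that by auto
  have M0: "M \<ge> 0" using order_trans[OF norm_ge_zero M[of 0]] \<rho> R by auto
  have "norm (foldr partial_deriv vs f x) \<le> A ^ length vs * fact (length vs) * M" 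
    if vs: "\<And>v. v \<in> set vs \<Longrightarrow> norm v \<le> V" and x: "norm x \<le> \<rho>" for vs x
  proof (cases "vs = []")
    case True
    then show ?thesis using M[of x] x R by simp
  next
    case False
    define k where "k = length vs"
    have k: "k > 0" using False by (simp add: k_def)
    have "norm (foldr partial_deriv vs f x) \<le> (?C * V / (R / k)) ^ length vs * M"
    proof (rule iterated_gradient_estimate[OF f])
      fix y assume "y \<in> cball x (length vs * (R / k))"
      then have "dist x y \<le> R" using k by (simp add: k_def)
      then show "norm (f y) \<le> M" using x dist_triangle[of 0 y x] by (intro M) auto
    qed (use R k vs in auto)
    also have "?C * V / (R / k) = A / exp 1 * k"
      using C V A by (simp add: R_def)
    also have "(A / exp 1 * k) ^ length vs = (A / exp 1) ^ k * real k ^ k"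
      unfolding k_def by (rule power_mult_distrib)
    also have "\<dots> * M \<le> (A / exp 1) ^ k * (fact k * exp (real k)) * M"
      using A M0 by (intro mult_right_mono mult_left_mono power_le_fact_exp) auto
    also have "\<dots> = A ^ k * fact k * M"
      by (simp add: power_divide flip: exp_of_nat_mult)
    finally show ?thesis by (simp add: k_def)
  qed
  with M0 that show ?thesis by blast
qed

lemma foldr_partial_deriv_replicate:
  "foldr partial_deriv (replicate k v) f = (partial_deriv v ^^ k) f"
  by (induction k) auto

text \<open>
  The remainder after \<open>p\<close> terms is an average of derivatives of order \<open>p\<close> divided by \<open>p!\<close>, and
  tends to 0 by the bound above, already with \<open>A = 1/2\<close>.
\<close>

lemma harmonic_taylor:
  fixes f :: "'a::euclidean_space \<Rightarrow> complex"
  assumes f: "harmonic_on UNIV f"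
  shows "(\<lambda>k. (partial_deriv v ^^ k) f x / fact k) sums f (x + v)"
proof -
  define D where "D k s = (partial_deriv v ^^ k) f (x + s *\<^sub>R v)" for k and s :: real
  have h: "harmonic_on UNIV ((partial_deriv v ^^ k) f)" for k
    using harmonic_iterated_partial_deriv[OF f, of "replicate k v"] by (simp add: foldr_partial_deriv_replicate)
  have D: "(D k has_vector_derivative D (Suc k) s) (at s within A)" for k s A
  proof (rule has_vector_derivative_at_within, unfold has_vector_derivative_def)
    have "(D k has_derivative (\<lambda>h. partial_deriv (h *\<^sub>R v) ((partial_deriv v ^^ k) f) (x + s *\<^sub>R v))) (at s)"
      unfolding D_def[abs_def]
      by (rule has_derivative_compose[OF _ harmonic_differentiable[OF h]]) (auto intro!: derivative_eq_intros)
    moreover have "partial_deriv (h *\<^sub>R v) ((partial_deriv v ^^ k) f) (x + s *\<^sub>R v) = h *\<^sub>R D (Suc k) s" for h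
      using linear_scale[OF bounded_linear.linear[OF has_derivative_bounded_linear[OF
            harmonic_differentiable[OF h]]], of h v k "x + s *\<^sub>R v"] by (simp add: D_def)
    ultimately show "(D k has_derivative (\<lambda>h. h *\<^sub>R D (Suc k) s)) (at s)" by simp
  qed
  obtain M where M: "M \<ge> 0" "\<And>vs y. \<lbrakk>\<And>w. w \<in> set vs \<Longrightarrow> norm w \<le> norm v + 1; norm y \<le> norm x + norm v\<rbrakk> \<Longrightarrow> 
      norm (foldr partial_deriv vs f y) \<le> (1/2) ^ length vs * fact (length vs) * M"
    by (rule iterated_derivatives_bound[OF f, of "1/2" "norm v + 1" "norm x + norm v"]) (auto simp: add_nonneg_pos)
  have bd: "norm (D k s) \<le> (1/2) ^ k * fact k * M" if "s \<in> {0..1}" for k s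
  proof -
    have "norm (x + s *\<^sub>R v) \<le> norm x + norm (s *\<^sub>R v)" by (rule norm_triangle_ineq)
    also have "norm (s *\<^sub>R v) \<le> norm v" using that by (auto intro: mult_left_le_one_le)
    finally show ?thesis using M(2)[of "replicate k v" "x + s *\<^sub>R v"]
      by (auto simp: foldr_partial_deriv_replicate D_def)
  qed
  have rem: "norm (f (x + v) - (\<Sum>i<Suc p. (partial_deriv v ^^ i) f x / fact i)) \<le> (1/2) ^ Suc p * real (Suc p) * M" for p
  proof -
    let ?i = "\<lambda>s. ((1 - s) ^ (Suc p - 1) / fact (Suc p - 1)) *\<^sub>R D (Suc p) s"
    have 1: "D 0 1 = f (x + v)" by (simp add: D_def)
    have T: "(?i has_integral D 0 1 - (\<Sum>i<Suc p. ((1 - 0) ^ i / fact i) *\<^sub>R D i 0)) {0..1}"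
      by (rule Taylor_has_integral[where Df = D]) (auto intro: D)
    have "norm (D 0 1 - (\<Sum>i<Suc p. ((1 - 0) ^ i / fact i) *\<^sub>R D i 0)) \<le> ((1/2) ^ Suc p * real (Suc p) * M) * measure lborel {0..1::real}"
    proof (rule has_integral_bound_real[OF _ finite.emptyI T])
      fix s :: real assume "s \<in> {0..1} - {}"
      then have s: "s \<in> {0..1}" by simp
      have "norm (?i s) = (1 - s) ^ p / fact p * norm (D (Suc p) s)" using s by simp
      also have "\<dots> \<le> 1 / fact p * ((1/2) ^ Suc p * fact (Suc p) * M)"
        using s bd[OF s, of "Suc p"] by (intro mult_mono divide_right_mono power_le_one) auto
      also have "\<dots> = (1/2) ^ Suc p * real (Suc p) * M" by simp
      finally show "norm (?i s) \<le> (1/2) ^ Suc p * real (Suc p) * M" .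
    qed (use M in auto)
    moreover have "((1 - 0) ^ i / fact i) *\<^sub>R D i 0 = (partial_deriv v ^^ i) f x / fact i" for i
      by (simp add: D_def scaleR_conv_of_real)
    ultimately show ?thesis unfolding 1 by simp
  qed
  have "(\<lambda>p. (1/2) ^ Suc p * real (Suc p) * M) \<longlonglongrightarrow> 0"
  proof -
    have "(\<lambda>n. real n * (1/2) ^ n) \<longlonglongrightarrow> 0" by (rule powser_times_n_limit_0) auto
    from tendsto_mult_left_zero[OF LIMSEQ_Suc[OF this], of M] show ?thesis by (simp add: mult_ac)
  qed
  then have "(\<lambda>p. f (x + v) - (\<Sum>i<Suc p. (partial_deriv v ^^ i) f x / fact i)) \<longlonglongrightarrow> 0"
    by (rule Lim_null_comparison[OF eventuallyI, rotated]) (rule rem)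
  then have "(\<lambda>p. f (x + v) - (\<Sum>i<p. (partial_deriv v ^^ i) f x / fact i)) \<longlonglongrightarrow> 0"
    by (rule LIMSEQ_imp_Suc)
  from tendsto_diff[OF tendsto_const[of "f (x + v)"] this] show ?thesis
    by (simp add: sums_def)
qed

text \<open>
  On the hyperplane all tangential derivatives of a function vanishing there are zero, so the
  Laplace equation forces the second normal derivative to vanish as well. Repeating this for the
  normal derivatives, which are again harmonic, kills all of them on the hyperplane, and the Taylor
  series in the normal direction shows that the function is zero.
\<close>

lemma harmonic_eq_0_from_cauchy_data:
  fixes f :: "'a::euclidean_space \<Rightarrow> complex"
  assumes f: "harmonic_on UNIV f" and e: "e \<in> Basis"
    and f0: "\<And>x. x \<bullet> e = 0 \<Longrightarrow> f x = 0" and f1: "\<And>x. x \<bullet> e = 0 \<Longrightarrow> partial_deriv e f x = 0"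
  shows "f x = 0"
proof -
  define t where "t = x \<bullet> e"
  define v where "v = t *\<^sub>R e"
  have sc: "partial_deriv v g y = t *\<^sub>R partial_deriv e g y" if "harmonic_on UNIV g" for g :: "'a \<Rightarrow> complex" and y
    unfolding v_def by (rule linear_scale[OF bounded_linear.linear[OF has_derivative_bounded_linear[OF
            harmonic_differentiable[OF that]]]])
  have h: "harmonic_on UNIV ((partial_deriv v ^^ k) f)" for k
    using harmonic_iterated_partial_deriv[OF f, of "replicate k v"] by (simp add: foldr_partial_deriv_replicate)
  have tang: "partial_deriv b g y = 0" if "\<And>x. x \<bullet> e = 0 \<Longrightarrow> g x = 0" "b \<in> Basis" "b \<noteq> e" "y \<bullet> e = 0" 
    for g :: "'a \<Rightarrow> complex" and b y
  proof -
    have "(\<lambda>s. g (y + s *\<^sub>R b)) = (\<lambda>s. 0)"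
      using that e by (auto simp: fun_eq_iff inner_simps inner_not_same_Basis)
    then show ?thesis by (simp add: partial_deriv_def)
  qed
  have normal: "partial_deriv v (partial_deriv v g) y = 0" 
    if g: "harmonic_on UNIV g" and g0: "\<And>x. x \<bullet> e = 0 \<Longrightarrow> g x = 0" and y: "y \<bullet> e = 0" for g y
  proof -
    have "laplacian g y = 0" using g by (simp add: harmonic_on_def)
    then have "partial_deriv e (partial_deriv e g) y + (\<Sum>b\<in>Basis - {e}. partial_deriv b (partial_deriv b g) y) = 0"
      unfolding laplacian_def by (simp add: sum.remove[OF _ e])
    moreover have "partial_deriv b (partial_deriv b g) y = 0" if "b \<in> Basis - {e}" for b
      using that y by (intro tang[of "partial_deriv b g"] tang[of g] g0) auto
    ultimately have z: "partial_deriv e (partial_deriv e g) y = 0" by simp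
    have "partial_deriv v g = (\<lambda>y. \<Sum>i\<in>{()}. complex_of_real t * partial_deriv e g y)"
      by (auto simp: sc[OF g] fun_eq_iff scaleR_conv_of_real)
    then have "partial_deriv e (partial_deriv v g) y = t * partial_deriv e (partial_deriv e g) y"
      using partial_deriv_sum_mult[of "{()}" "\<lambda>_. partial_deriv e g" e "\<lambda>_. complex_of_real t" y] harmonic_partial_deriv[OF g] by simp
    then show ?thesis using z by (simp add: sc harmonic_partial_deriv g)
  qed
  have van: "\<forall>y. y \<bullet> e = 0 \<longrightarrow> (partial_deriv v ^^ k) f y = 0 \<and> (partial_deriv v ^^ Suc k) f y = 0" for k
  proof (induction k)
    case 0
    then show ?case by (auto simp: f0 f1 sc f)
  next
    case (Suc k)
    then show ?case using normal[OF h[of k]] by auto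
  qed
  have "(x - v) \<bullet> e = 0" using e by (simp add: v_def t_def inner_simps)
  then have "(\<lambda>k. 0) sums f (x - v + v)"
    using harmonic_taylor[OF f, of v "x - v"] van by simp
  then show ?thesis by (simp add: sums_iff)
qed

section \<open>Polarization of Taylor series\<close>

text \<open>
  A list of length \<open>k\<close> of signed basis vectors encodes both an iterated partial derivative (the
  vectors) and a choice of signs, that is, one summand of the polarization identity.
\<close>

definition signed_bases :: "nat \<Rightarrow> ('a::euclidean_space \<times> real) list set" where
  "signed_bases k = {js. set js \<subseteq> Basis \<times> {1, -1} \<and> length js = k}"

abbreviation sign_prod :: "('a \<times> real) list \<Rightarrow> real" where
  "sign_prod js \<equiv> prod_list (map snd js)"

abbreviation signed_sum :: "('a::euclidean_space \<times> real) list \<Rightarrow> 'a" where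
  "signed_sum js \<equiv> sum_list (map (\<lambda>(b, \<epsilon>). \<epsilon> *\<^sub>R b) js)"

lemma card_signed_bases: "card (signed_bases k :: ('a::euclidean_space \<times> real) list set) = (2 * DIM('a)) ^ k"
  unfolding signed_bases_def by (subst card_lists_length_eq) (auto simp: card_cartesian_product simp flip: mult_2)

lemma sum_signed_bases_Suc:
  "(\<Sum>js\<in>signed_bases (Suc k). F js) = 
    (\<Sum>b\<in>Basis. \<Sum>js\<in>signed_bases k. F ((b::'a::euclidean_space, 1) # js) + F ((b, -1) # js))"
proof -
  have "(\<Sum>js\<in>signed_bases (Suc k). F js) = (\<Sum>(js, a)\<in>signed_bases k \<times> (Basis \<times> {1, -1}). F (a # js))"
    unfolding signed_bases_def lists_length_Suc_eq
    by (subst sum.reindex) (auto simp: inj_on_def case_prod_unfold)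
  also have "\<dots> = (\<Sum>js\<in>signed_bases k. \<Sum>b\<in>Basis. F ((b, 1) # js) + F ((b, -1) # js))"
    by (subst sum.cartesian_product[symmetric], intro sum.cong refl)
      (simp add: sum.cartesian_product')
  also have "\<dots> = (\<Sum>b\<in>Basis. \<Sum>js\<in>signed_bases k. F ((b, 1) # js) + F ((b, -1) # js))"
    by (rule sum.swap)
  finally show ?thesis .
qed

lemma symmetric_difference_power:
  fixes a b :: "'a::comm_ring_1"
  shows "(a + b) ^ m - (a - b) ^ m = (\<Sum>l<m. of_nat (m choose l) * (1 - (-1) ^ (m - l)) * b ^ (m - l) * a ^ l)"
proof -
  have "(a + b) ^ m - (a + (- b)) ^ m = (\<Sum>l\<le>m. of_nat (m choose l) * (1 - (-1) ^ (m - l)) * b ^ (m - l) * a ^ l)"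
    unfolding binomial_ring sum_subtractf[symmetric]
    by (intro sum.cong refl) (simp add: power_minus[of b] algebra_simps)
  then show ?thesis by (simp flip: lessThan_Suc_atMost)
qed

text \<open>
  The term of order \<open>k\<close> in the Taylor series is a sum of products \<open>(v \<bullet> b\<^sub>1) \<cdots> (v \<bullet> b\<^sub>k)\<close> weighted by
  iterated derivatives. Polarization writes such a product as a signed sum of the \<open>k\<close>-th powers of
  \<open>v \<bullet> (\<epsilon>\<^sub>1 b\<^sub>1 + \<cdots> + \<epsilon>\<^sub>k b\<^sub>k)\<close>. The induction takes one symmetric difference at a time: each
  difference lowers the degree of a polynomial by one. Therefore the statement includes a shift \<open>s\<close>
  and the exponents \<open>m < k\<close>, for which the sum is zero.
\<close>

lemma polarization:
  fixes f :: "'a::euclidean_space \<Rightarrow> complex"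
  assumes f: "harmonic_on UNIV f" and "m \<le> k"
  shows "(\<Sum>js\<in>signed_bases k. of_real (sign_prod js * (s + v \<bullet> signed_sum js) ^ m) *
      foldr partial_deriv (map fst js) f x) = (if m < k then 0 else 2 ^ k * fact k * (partial_deriv v ^^ k) f x)"
  using assms(2)
proof (induction k arbitrary: m s x)
  case 0
  have "signed_bases 0 = {[] :: ('a \<times> real) list}" by (auto simp: signed_bases_def)
  with 0 show ?case by simp
next
  case (Suc k)
  define T where "T js = foldr partial_deriv (map fst js) f" for js :: "('a \<times> real) list"
  have hT: "harmonic_on UNIV (T js)" for js
    unfolding T_def by (rule harmonic_iterated_partial_deriv[OF f])
  have hk: "harmonic_on UNIV ((partial_deriv v ^^ k) f)"
    using harmonic_iterated_partial_deriv[OF f, of "replicate k v"] by (simp add: foldr_partial_deriv_replicate)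
  \<comment> \<open>The coefficients of the symmetric difference as a polynomial of degree less than \<open>m\<close>.\<close>
  define \<kappa> where "\<kappa> b l = real (m choose l) * (1 - (-1) ^ (m - l)) * (v \<bullet> b) ^ (m - l)" for b l
  have IH: "(\<lambda>x. \<Sum>js\<in>signed_bases k. of_real (sign_prod js * (s + v \<bullet> signed_sum js) ^ l) * T js x) = 
     (\<lambda>x. if l < k then 0 else 2 ^ k * fact k * (partial_deriv v ^^ k) f x)" if "l < m" for l
    unfolding T_def using that Suc.prems by (intro ext Suc.IH) auto
  have P: "partial_deriv b (\<lambda>x. if l < k then 0 else 2 ^ k * fact k * (partial_deriv v ^^ k) f x) x = 
     (if l < k then 0 else 2 ^ k * fact k * partial_deriv b ((partial_deriv v ^^ k) f) x)" for b l
  proof (cases "l < k")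
    case True
    then show ?thesis by (simp add: partial_deriv_def)
  next
    case False
    then show ?thesis
      using partial_deriv_sum_mult[of "{()}" "\<lambda>_. (partial_deriv v ^^ k) f" b "\<lambda>_. 2 ^ k * fact k" x] hk by simp
  qed
  have "(\<Sum>js\<in>signed_bases (Suc k). of_real (sign_prod js * (s + v \<bullet> signed_sum js) ^ m) *
      foldr partial_deriv (map fst js) f x) = (\<Sum>b\<in>Basis. \<Sum>js\<in>signed_bases k. 
        of_real (sign_prod js * (((s + v \<bullet> signed_sum js) + v \<bullet> b) ^ m - ((s + v \<bullet> signed_sum js) - v \<bullet> b) ^ m)) * partial_deriv b (T js) x)"
    unfolding sum_signed_bases_Suc
    by (intro sum.cong refl) (simp add: T_def inner_simps algebra_simps)
  also have "\<dots> = (\<Sum>b\<in>Basis. \<Sum>js\<in>signed_bases k. \<Sum>l<m. of_real (\<kappa> b l) *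
        (of_real (sign_prod js * (s + v \<bullet> signed_sum js) ^ l) * partial_deriv b (T js) x))"
    unfolding symmetric_difference_power
    by (intro sum.cong refl) (simp add: \<kappa>_def sum_distrib_left sum_distrib_right mult_ac)
  also have "\<dots> = (\<Sum>b\<in>Basis. \<Sum>l<m. of_real (\<kappa> b l) * (\<Sum>js\<in>signed_bases k. 
        of_real (sign_prod js * (s + v \<bullet> signed_sum js) ^ l) * partial_deriv b (T js) x))"
    unfolding sum_distrib_left by (intro sum.cong refl sum.swap)
  also have "\<dots> = (\<Sum>b\<in>Basis. \<Sum>l<m. of_real (\<kappa> b l) * (if l < k then 0 else 2 ^ k * fact k * partial_deriv b ((partial_deriv v ^^ k) f) x))"
    by (intro sum.cong refl) (simp only: partial_deriv_sum_mult[OF hT, symmetric] IH P lessThan_iff)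
  also have "\<dots> = (if m < Suc k then 0 else 2 ^ Suc k * fact (Suc k) * (partial_deriv v ^^ Suc k) f x)"
  proof (cases "m < Suc k")
    case True
    then show ?thesis by (simp add: sum.neutral)
  next
    case False
    with Suc.prems have m: "m = Suc k" by simp
    have "(\<Sum>b\<in>Basis. \<Sum>l<m. of_real (\<kappa> b l) * (if l < k then 0 else 2 ^ k * fact k * partial_deriv b ((partial_deriv v ^^ k) f) x))
      = (\<Sum>b\<in>Basis. of_real (\<kappa> b k) * (2 ^ k * fact k * partial_deriv b ((partial_deriv v ^^ k) f) x))"
      unfolding m by simp
    also have "\<dots> = 2 ^ Suc k * fact (Suc k) * (\<Sum>b\<in>Basis. of_real (v \<bullet> b) * partial_deriv b ((partial_deriv v ^^ k) f) x)"
      unfolding sum_distrib_left by (intro sum.cong refl) (simp add: \<kappa>_def m algebra_simps)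
    also have "\<dots> = 2 ^ Suc k * fact (Suc k) * (partial_deriv v ^^ Suc k) f x"
      by (simp flip: partial_deriv_euclidean[OF hk])
    finally show ?thesis using m by simp
  qed
  finally show ?case .
qed

section \<open>Series of harmonic functions\<close>

lemma norm_le_norm_add_dist:
  fixes x y :: "'a::real_normed_vector"
  shows "norm y \<le> norm x + dist x y"
  by (metis dist_norm dist_commute norm_triangle_sub)

lemma summable_locally_dominated:
  fixes u :: "nat \<Rightarrow> 'a::real_normed_vector \<Rightarrow> 'c::banach"
  assumes "\<exists>B. summable B \<and> (\<forall>k x. norm x \<le> R \<longrightarrow> norm (u k x) \<le> B k)" "norm x \<le> R"
  shows "summable (\<lambda>k. u k x)"
proof -
  obtain B where B: "summable B" "\<And>k. norm (u k x) \<le> B k" using assms by blast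
  show ?thesis by (rule summable_comparison_test'[OF B(1), of 0]) (rule B(2))
qed

lemma has_derivative_suminf:
  fixes u :: "nat \<Rightarrow> 'a::real_normed_vector \<Rightarrow> 'c::banach"
  assumes der: "\<And>k x. (u k has_derivative blinfun_apply (U k x)) (at x)"
    and sm: "\<And>x. summable (\<lambda>k. u k x)"
    and bd: "\<And>R. \<exists>B. summable B \<and> (\<forall>k x. norm x \<le> R \<longrightarrow> norm (U k x) \<le> B k)"
  shows "((\<lambda>x. \<Sum>k. u k x) has_derivative blinfun_apply (\<Sum>k. U k x)) (at x)"
proof -
  let ?S = "ball 0 (norm x + 1) :: 'a set"
  obtain B where B: "summable B" "\<And>k y. norm y \<le> norm x + 1 \<Longrightarrow> norm (U k y) \<le> B k"
    using bd[of "norm x + 1"] by blast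
  have unif: "uniform_limit ?S (\<lambda>n y. \<Sum>k<n. U k y) (\<lambda>y. \<Sum>k. U k y) sequentially"
    by (rule Weierstrass_m_test[OF _ B(1)]) (auto intro: B(2))
  have "\<exists>g. \<forall>y\<in>?S. (\<lambda>k. u k y) sums g y \<and> (g has_derivative blinfun_apply (\<Sum>k. U k y)) (at y within ?S)"
  proof (rule has_derivative_series[of ?S u "\<lambda>k y. blinfun_apply (U k y)" "\<lambda>y. blinfun_apply (\<Sum>k. U k y)" x "\<Sum>k. u k x"])
    fix e :: real assume e: "e > 0"
    show "\<forall>\<^sub>F n in sequentially. \<forall>y\<in>?S. \<forall>h. norm ((\<Sum>k<n. U k y h) - blinfun_apply (\<Sum>k. U k y) h) \<le> e * norm h"
      using uniform_limitD[OF unif e]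
    proof eventually_elim
      case (elim n)
      show ?case
      proof (intro ballI allI)
        fix y h assume "y \<in> ?S"
        with elim have "norm ((\<Sum>k<n. U k y) - (\<Sum>k. U k y)) \<le> e" by (auto simp: dist_norm less_imp_le)
        then have "norm (((\<Sum>k<n. U k y) - (\<Sum>k. U k y)) h) \<le> e * norm h"
          by (rule order_trans[OF norm_blinfun mult_right_mono]) auto
        then show "norm ((\<Sum>k<n. U k y h) - blinfun_apply (\<Sum>k. U k y) h) \<le> e * norm h"
          by (simp add: blinfun.diff_left blinfun.sum_left)
      qed
    qed
  qed (auto intro: has_derivative_at_withinI der summable_sums[OF sm])
  then obtain g where g: "\<And>y. y \<in> ?S \<Longrightarrow> (\<lambda>k. u k y) sums g y"
     "\<And>y. y \<in> ?S \<Longrightarrow> (g has_derivative blinfun_apply (\<Sum>k. U k y)) (at y within ?S)" by blast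
  have xS: "x \<in> ?S" by simp
  have "(g has_derivative blinfun_apply (\<Sum>k. U k x)) (at x)"
    using g(2)[OF xS] by (subst (asm) at_within_open) auto
  then show ?thesis
  proof (rule has_derivative_transform_within_open[of _ _ _ _ ?S])
    show "g y = (\<Sum>k. u k y)" if "y \<in> ?S" for y
      using g(1)[OF that] by (rule sums_unique)
  qed auto
qed

text \<open>
  By the gradient estimate a locally uniform bound for the terms bounds their first and second
  derivatives on smaller balls, so the series may be differentiated twice term by term.
\<close>

lemma harmonic_suminf:
  fixes u :: "nat \<Rightarrow> 'a::euclidean_space \<Rightarrow> complex"
  assumes h: "\<And>k. harmonic_on UNIV (u k)"
    and bd: "\<And>R. \<exists>B. summable B \<and> (\<forall>k x. norm x \<le> R \<longrightarrow> norm (u k x) \<le> B k)"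
  shows "summable (\<lambda>k. u k x)" and "harmonic_on UNIV (\<lambda>x. \<Sum>k. u k x)"
    and "(\<lambda>k. partial_deriv v (u k) x) sums partial_deriv v (\<lambda>x. \<Sum>k. u k x) x"
proof -
  let ?C = "gradient_const TYPE('a)"
  have C: "?C \<ge> 1" by (rule gradient_const_ge_1)
  define P where "P k U U' \<longleftrightarrow> (\<forall>x. (u k has_derivative blinfun_apply (U x)) (at x)) \<and>
    (\<forall>x. (U has_derivative blinfun_apply (U' x)) (at x)) \<and> continuous_on UNIV U' \<and> (\<forall>x. (\<Sum>b\<in>Basis. U' x b b) = 0) \<and>
    (\<forall>v x. partial_deriv v (u k) x = U x v) \<and> (\<forall>v w x. partial_deriv v (partial_deriv w (u k)) x = U' x v w)" for k U U'
  have "\<exists>p. P k (fst p) (snd p)" for k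
  proof (rule harmonicE[OF h[of k]])
    fix U U'
    assume "\<And>x. (u k has_derivative blinfun_apply (U x)) (at x)" "\<And>x. (U has_derivative blinfun_apply (U' x)) (at x)"
      "continuous_on UNIV U'" "\<And>x. (\<Sum>b\<in>Basis. U' x b b) = 0"
      "\<And>v x. partial_deriv v (u k) x = U x v" "\<And>v w x. partial_deriv v (partial_deriv w (u k)) x = U' x v w"
    then show ?thesis unfolding P_def by (intro exI[of _ "(U, U')"]) simp
  qed
  then obtain p where p: "\<And>k. P k (fst (p k)) (snd (p k))" using choice[of "\<lambda>k p. P k (fst p) (snd p)"] by blast
  define U where "U k = fst (p k)" for k
  define U' where "U' k = snd (p k)" for k
  have "P k (U k) (U' k)" for k using p by (simp add: U_def U'_def)
  then have U: "\<And>k x. (u k has_derivative blinfun_apply (U k x)) (at x)" 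
      "\<And>k x. (U k has_derivative blinfun_apply (U' k x)) (at x)"
      "\<And>k. continuous_on UNIV (U' k)" "\<And>k x. (\<Sum>b\<in>Basis. U' k x b b) = 0"
      "\<And>k v x. partial_deriv v (u k) x = U k x v"
      "\<And>k v w x. partial_deriv v (partial_deriv w (u k)) x = U' k x v w"
    unfolding P_def by blast+
  have sm: "summable (\<lambda>k. u k x)" for x
    by (rule summable_locally_dominated[OF bd[of "norm x"] order_refl])
  have bd1: "\<exists>B. summable B \<and> (\<forall>k x. norm x \<le> R \<longrightarrow> norm (U k x) \<le> B k)" for R
  proof -
    obtain B where B: "summable B" "\<And>k y. norm y \<le> R + 1 \<Longrightarrow> norm (u k y) \<le> B k" using bd[of "R + 1"] by blast
    have "norm (U k x) \<le> ?C * B k" if x: "norm x \<le> R" for k x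
    proof (rule norm_blinfun_bound)
      have B0: "B k \<ge> 0" using order_trans[OF norm_ge_zero B(2)[of x k]] x by simp
      then show "0 \<le> ?C * B k" using C by simp
      show "norm (U k x v) \<le> ?C * B k * norm v" for v
      proof -
        have "norm (partial_deriv v (u k) x) \<le> ?C * norm v / 1 * B k"
        proof (rule gradient_estimate[OF h])
          fix y assume "y \<in> cball x 1"
          then show "norm (u k y) \<le> B k"
            using x norm_le_norm_add_dist[of y x] by (intro B) simp
        qed simp
        then show ?thesis by (simp only: U(5) div_by_1 mult_ac)
      qed
    qed
    then show ?thesis using B(1) by (intro exI[of _ "\<lambda>k. ?C * B k"]) (auto intro: summable_mult)
  qed
  have bd2: "\<exists>B. summable B \<and> (\<forall>k x. norm x \<le> R \<longrightarrow> norm (U' k x) \<le> B k)" for R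
  proof -
    obtain B where B: "summable B" "\<And>k y. norm y \<le> R + 2 \<Longrightarrow> norm (u k y) \<le> B k" using bd[of "R + 2"] by blast
    have "norm (U' k x) \<le> ?C * (?C * B k)" if x: "norm x \<le> R" for k x
    proof (rule norm_blinfun_bound)
      have B0: "B k \<ge> 0" using order_trans[OF norm_ge_zero B(2)[of x k]] x by simp
      then show "0 \<le> ?C * (?C * B k)" using C by simp
      fix v
      show "norm (U' k x v) \<le> ?C * (?C * B k) * norm v"
      proof (rule norm_blinfun_bound)
        show "0 \<le> ?C * (?C * B k) * norm v" using C B0 by simp
        fix w
        have 1: "norm (partial_deriv w (u k) y) \<le> ?C * norm w / 1 * B k" if y: "y \<in> cball x 1" for y
        proof (rule gradient_estimate[OF h])
          fix z assume "z \<in> cball y 1"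
          then show "norm (u k z) \<le> B k"
            using y x norm_le_norm_add_dist[of z y] norm_le_norm_add_dist[of y x] by (intro B) simp
        qed auto
        have "norm (partial_deriv v (partial_deriv w (u k)) x) \<le> ?C * norm v / 1 * (?C * norm w / 1 * B k)"
          by (rule gradient_estimate[OF harmonic_partial_deriv[OF h]]) (auto intro: 1[unfolded div_by_1])
        then show "norm (U' k x v w) \<le> ?C * (?C * B k) * norm v * norm w"
          by (simp only: U(6) div_by_1 mult_ac)
      qed
    qed
    then show ?thesis using B(1) by (intro exI[of _ "\<lambda>k. ?C * (?C * B k)"]) (auto intro: summable_mult)
  qed
  have sm1: "summable (\<lambda>k. U k x)" for x
    by (rule summable_locally_dominated[OF bd1[of "norm x"] order_refl])
  have sm2: "summable (\<lambda>k. U' k x)" for x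
    by (rule summable_locally_dominated[OF bd2[of "norm x"] order_refl])
  have d1: "((\<lambda>x. \<Sum>k. u k x) has_derivative blinfun_apply (\<Sum>k. U k x)) (at x)" for x
    by (rule has_derivative_suminf[OF U(1) sm bd1])
  have d2: "((\<lambda>x. \<Sum>k. U k x) has_derivative blinfun_apply (\<Sum>k. U' k x)) (at x)" for x
    by (rule has_derivative_suminf[OF U(2) sm1 bd2])
  show "summable (\<lambda>k. u k x)" by (rule sm)
  have "(\<lambda>k. U k x v) sums (blinfun_apply (\<Sum>k. U k x) v)"
    by (rule bounded_linear.sums[OF blinfun.bounded_linear_left summable_sums[OF sm1]])
  then show "(\<lambda>k. partial_deriv v (u k) x) sums partial_deriv v (\<lambda>x. \<Sum>k. u k x) x"
    by (simp add: U(5) partial_deriv_eq[OF d1])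
  show "harmonic_on UNIV (\<lambda>x. \<Sum>k. u k x)"
  proof (rule harmonicI[OF d1 d2])
    have "isCont (\<lambda>x. \<Sum>k. U' k x) x" for x
    proof -
      let ?S = "ball 0 (norm x + 1) :: 'a set"
      obtain B where B: "summable B" "\<And>k y. norm y \<le> norm x + 1 \<Longrightarrow> norm (U' k y) \<le> B k"
        using bd2[of "norm x + 1"] by blast
      have "uniform_limit ?S (\<lambda>n y. \<Sum>k<n. U' k y) (\<lambda>y. \<Sum>k. U' k y) sequentially"
        by (rule Weierstrass_m_test[OF _ B(1)]) (auto intro: B(2))
      then have "continuous_on ?S (\<lambda>y. \<Sum>k. U' k y)"
        by (rule uniform_limit_theorem[rotated])
          (auto intro!: always_eventually continuous_intros continuous_on_subset[OF U(3)])
      then show ?thesis by (simp add: continuous_on_eq_continuous_at)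
    qed
    then show "continuous_on UNIV (\<lambda>x. \<Sum>k. U' k x)" by (simp add: continuous_at_imp_continuous_on)
    fix x
    have "bounded_linear (\<lambda>A :: 'a \<Rightarrow>\<^sub>L 'a \<Rightarrow>\<^sub>L complex. \<Sum>b\<in>Basis. A b b)"
      by (intro bounded_linear_intros bounded_linear_sum)
    from bounded_linear.suminf[OF this sm2, of x]
    show "(\<Sum>b\<in>Basis. (\<Sum>k. U' k x) b b) = 0" by (simp add: U(4))
  qed
qed

section \<open>The difference equation for powers of a complex variable\<close>

text \<open>
  The circles pass halfway between consecutive zeros \<open>2\<pi>i n\<close> of \<open>exp w - 1\<close>. Away from the
  imaginary axis \<open>|exp w|\<close> is bounded away from 1; near it the imaginary part of \<open>w\<close> is close to an
  odd multiple of \<open>\<pi>\<close>, where \<open>exp w\<close> has nonpositive real part.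
\<close>

lemma norm_exp_minus_1_ge:
  fixes w :: complex
  assumes w: "norm w = (2 * real k + 1) * pi"
  shows "norm (exp w - 1) \<ge> 1/2"
proof -
  define x where "x = Re w"
  define y where "y = \<bar>Im w\<bar>"
  define r where "r = (2 * real k + 1) * pi"
  consider "x \<ge> 1" | "x \<le> -1" | "\<bar>x\<bar> < 1" by linarith
  then show ?thesis
  proof cases
    case 1
    have "1 \<le> exp x - 1" using exp_ge_add_one_self[of x] 1 by linarith
    also have "\<dots> \<le> norm (exp w - 1)" using norm_triangle_ineq2[of "exp w" 1] by (simp add: x_def)
    finally show ?thesis by simp
  next
    case 2
    have "2 \<le> exp (-x)" using exp_ge_add_one_self[of "-x"] 2 by linarith
    then have "exp x \<le> 1/2" by (simp add: exp_minus field_simps)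
    then have "1/2 \<le> 1 - exp x" by simp
    also have "\<dots> \<le> norm (exp w - 1)" using norm_triangle_ineq2[of 1 "exp w"] by (simp add: x_def norm_minus_commute)
    finally show ?thesis by simp
  next
    case 3
    have r: "r \<ge> 3" using pi_gt3 mult_mono[of 1 "2 * real k + 1" 3 pi] by (simp add: r_def)
    have "r\<^sup>2 = x\<^sup>2 + y\<^sup>2" using w by (simp add: r_def x_def y_def cmod_power2 flip: w)
    then have "(r - y) * (r + y) = x\<^sup>2" by (simp add: power2_eq_square algebra_simps)
    moreover have "x\<^sup>2 \<le> 1" using 3 by (simp add: abs_square_le_1)
    moreover have "y \<ge> 0" by (simp add: y_def)
    ultimately have prod: "(r - y) * (r + y) \<le> 1" "0 \<le> (r - y) * (r + y)" by auto
    have d0: "0 \<le> r - y" using prod(2) r \<open>y \<ge> 0\<close> by (simp add: zero_le_mult_iff)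
    have "(r - y) * 3 \<le> (r - y) * (r + y)" using d0 r \<open>y \<ge> 0\<close> by (intro mult_left_mono) auto
    from order_trans[OF this prod(1)] have d1: "r - y \<le> 1" by simp
    have "cos (Im w) = cos y" by (simp add: y_def)
    also have "\<dots> = cos (pi * of_int (2 * int k + 1) - (r - y))" by (simp add: r_def algebra_simps)
    also have "\<dots> = - cos (r - y)"
    proof -
      have "cos (pi * of_int (2 * int k + 1)) = -1" by (subst cos_npi_int) simp
      moreover have "sin (pi * of_int (2 * int k + 1)) = 0" by (rule sin_npi_int)
      ultimately show ?thesis unfolding cos_diff[of "pi * of_int (2 * int k + 1)"] by simp
    qed
    also have "\<dots> \<le> 0" using d0 d1 pi_gt3 cos_ge_zero[of "r - y"] by simp
    finally have "Re (exp w - 1) \<le> -1"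
      by (simp add: Re_exp mult_nonneg_nonpos)
    then show ?thesis using abs_Re_le_cmod[of "exp w - 1"] by linarith
  qed
qed

text \<open>
  An entire solution of \<open>G (z + 1) - G z = z\<^sup>k\<close>. Formally, \<open>z\<^sup>k\<close> is \<open>k!\<close> times the residue at 0 of
  \<open>exp (z w) / w\<^sup>k\<^sup>+\<^sup>1\<close>, and dividing the integrand by \<open>exp w - 1\<close> inverts the difference operator. On
  a small circle the integral is the Bernoulli polynomial of degree \<open>k + 1\<close> divided by \<open>k + 1\<close>,
  which is too large for summation over \<open>k\<close>. Letting the radius grow with \<open>k\<close> changes the solution by
  1-periodic exponentials only and makes \<open>k! / r\<^sup>k\<close> at most 1.
\<close>

definition guichard :: "nat \<Rightarrow> complex \<Rightarrow> complex" where
  "guichard k z = fact k / (2 * pi * \<i>) * 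
     contour_integral (circlepath 0 ((2 * real k + 1) * pi)) (\<lambda>w. exp (z * w) / ((exp w - 1) * w ^ Suc k))"

lemma guichard_kernel_nonzero:
  fixes w :: complex
  assumes "norm w = (2 * real k + 1) * pi"
  shows "exp w - 1 \<noteq> 0" "w \<noteq> 0"
proof -
  show "exp w - 1 \<noteq> 0" using norm_exp_minus_1_ge[OF assms] by auto
  have "(2 * real k + 1) * pi > 0" by (intro mult_pos_pos) auto
  then show "w \<noteq> 0" using assms by auto
qed

lemma guichard_integrable:
  "(\<lambda>w. exp (z * w) / ((exp w - 1) * w ^ Suc k)) contour_integrable_on circlepath 0 ((2 * real k + 1) * pi)"
proof (rule contour_integrable_continuous_circlepath, intro continuous_intros ballI)
  fix w assume "w \<in> path_image (circlepath 0 ((2 * real k + 1) * pi))"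
  then have "norm w = (2 * real k + 1) * pi" by simp
  from guichard_kernel_nonzero[OF this] show "(exp w - 1) * w ^ Suc k \<noteq> 0" by simp
qed

lemma guichard_difference: "guichard k (z + 1) - guichard k z = z ^ k"
proof -
  let ?r = "(2 * real k + 1) * pi"
  have r: "?r > 0" by (intro mult_pos_pos) auto
  have hd: "(deriv ^^ n) (\<lambda>w. exp (z * w)) = (\<lambda>w. z ^ n * exp (z * w))" for n
  proof (induction n)
    case (Suc n)
    have "deriv (\<lambda>w. z ^ n * exp (z * w)) w = z ^ Suc n * exp (z * w)" for w
      by (rule DERIV_imp_deriv) (auto intro!: derivative_eq_intros)
    then show ?case by (simp add: Suc fun_eq_iff)
  qed auto
  have "guichard k (z + 1) - guichard k z = fact k / (2 * pi * \<i>) *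
     contour_integral (circlepath 0 ?r) (\<lambda>w. exp ((z + 1) * w) / ((exp w - 1) * w ^ Suc k) - exp (z * w) / ((exp w - 1) * w ^ Suc k))"
    unfolding guichard_def contour_integral_diff[OF guichard_integrable guichard_integrable] by (simp add: right_diff_distrib)
  also have "contour_integral (circlepath 0 ?r) (\<lambda>w. exp ((z + 1) * w) / ((exp w - 1) * w ^ Suc k) - exp (z * w) / ((exp w - 1) * w ^ Suc k))
     = contour_integral (circlepath 0 ?r) (\<lambda>w. exp (z * w) / (w - 0) ^ Suc k)"
  proof (rule contour_integral_cong)
    fix w assume "w \<in> path_image (circlepath 0 ?r)"
    then have "norm w = ?r" by simp
    note nz = guichard_kernel_nonzero[OF this]
    have "exp ((z + 1) * w) / ((exp w - 1) * w ^ Suc k) - exp (z * w) / ((exp w - 1) * w ^ Suc k) = 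
      ((exp w - 1) * exp (z * w)) / ((exp w - 1) * w ^ Suc k)"
      by (simp add: exp_add algebra_simps flip: diff_divide_distrib)
    also have "\<dots> = exp (z * w) / (w - 0) ^ Suc k" using nz by simp
    finally show "exp ((z + 1) * w) / ((exp w - 1) * w ^ Suc k) - exp (z * w) / ((exp w - 1) * w ^ Suc k) = exp (z * w) / (w - 0) ^ Suc k" .
  qed simp
  also have "\<dots> = (2 * pi * \<i>) / fact k * (deriv ^^ k) (\<lambda>w. exp (z * w)) 0"
    by (rule contour_integral_unique, rule Cauchy_has_contour_integral_higher_derivative_circlepath)
      (use r in \<open>auto intro!: continuous_intros holomorphic_intros\<close>)
  also have "\<dots> = (2 * pi * \<i>) / fact k * z ^ k" by (simp add: hd)
  finally show ?thesis by simp
qed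

text \<open>
  For fixed \<open>R\<close> the growth in \<open>k\<close> is only geometric, so every series with coefficients decaying
  faster than geometric sequences can be summed with these functions.
\<close>

lemma guichard_bound:
  assumes "norm z \<le> R"
  shows "norm (guichard k z) \<le> (2 * exp (2 * pi * R)) ^ Suc k"
proof -
  define r where "r = (2 * real k + 1) * pi"
  have r: "r > 0" unfolding r_def by (intro mult_pos_pos) auto
  have kr: "real k \<le> r" using pi_gt3 mult_mono[of "real k" "2 * real k + 1" 1 pi] by (simp add: r_def)
  have R: "R \<ge> 0" using assms norm_ge_zero order_trans by blast
  have "norm (contour_integral (circlepath 0 r) (\<lambda>w. exp (z * w) / ((exp w - 1) * w ^ Suc k)))
    \<le> (exp (R * r) / (1/2 * r ^ Suc k)) * (2 * pi * r)"
  proof (rule has_contour_integral_bound_circlepath)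
    show "((\<lambda>w. exp (z * w) / ((exp w - 1) * w ^ Suc k)) has_contour_integral 
        contour_integral (circlepath 0 r) (\<lambda>w. exp (z * w) / ((exp w - 1) * w ^ Suc k))) (circlepath 0 r)"
      unfolding r_def by (rule has_contour_integral_integral[OF guichard_integrable])
  next
    fix w :: complex assume "norm (w - 0) = r"
    then have w: "norm w = r" by simp
    have "Re (z * w) \<le> R * r"
      by (rule order_trans[OF complex_Re_le_cmod]) (use mult_right_mono[OF assms, of r] r in \<open>simp only: norm_mult w less_imp_le\<close>)
    then have "norm (exp (z * w)) \<le> exp (R * r)" by simp
    moreover have "1/2 * r ^ Suc k \<le> norm ((exp w - 1) * w ^ Suc k)"
      unfolding norm_mult norm_power w using norm_exp_minus_1_ge[OF w[unfolded r_def]] r by (intro mult_right_mono) auto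
    ultimately show "norm (exp (z * w) / ((exp w - 1) * w ^ Suc k)) \<le> exp (R * r) / (1/2 * r ^ Suc k)"
      unfolding norm_divide using r by (intro frac_le) auto
  qed (use r in auto)
  then have "norm (guichard k z) \<le> fact k / (2 * pi) * ((exp (R * r) / (1/2 * r ^ Suc k)) * (2 * pi * r))"
    unfolding guichard_def r_def[symmetric] norm_mult norm_divide by (intro mult_mono) (auto simp: norm_mult)
  also have "\<dots> = 2 * exp (R * r) * (fact k / r ^ k)"
    using r by (simp add: field_simps)
  also have "\<dots> \<le> 2 * exp (R * r) * 1"
  proof (intro mult_left_mono)
    have "fact k \<le> real k ^ k" using fact_le_power[of k, where 'a = real] by simp
    also have "\<dots> \<le> r ^ k" using kr by (intro power_mono) auto
    finally show "fact k / r ^ k \<le> 1" using r by (simp add: divide_le_eq_1)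
  qed auto
  also have "\<dots> \<le> 2 ^ Suc k * exp (2 * pi * R * Suc k)"
  proof -
    have "R * r \<le> 2 * pi * R * Suc k" using R by (simp add: r_def algebra_simps)
    then show ?thesis by (simp only: mult_1_right) (intro mult_mono, auto)
  qed
  also have "\<dots> = (2 * exp (2 * pi * R)) ^ Suc k"
    by (simp only: power_mult_distrib exp_of_nat2_mult)
  finally show ?thesis .
qed

lemma guichard_holomorphic: "guichard k holomorphic_on UNIV"
proof -
  let ?r = "(2 * real k + 1) * pi"
  have r: "?r > 0" by (intro mult_pos_pos) auto
  define p where "p = circlepath 0 ?r"
  define p' where "p' t = vector_derivative p (at t)" for t
  have p: "p t = ?r * exp (2 * of_real pi * \<i> * of_real t)" for t
    by (simp add: p_def circlepath)
  have p': "p' t = 2 * pi * \<i> * ?r * exp (2 * of_real pi * \<i> * of_real t)" for t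
    by (simp add: p_def p'_def vector_derivative_circlepath)
  have np: "norm (p t) = ?r" for t
    using r by (simp only: p norm_mult norm_of_real norm_exp_eq_Re) simp
  have cp: "continuous_on A p" "continuous_on A p'" for A
    unfolding p[abs_def] p'[abs_def] by (intro continuous_intros)+
  have nz: "(exp (p t) - 1) * p t ^ Suc k \<noteq> 0" for t
    using guichard_kernel_nonzero[OF np] by simp
  let ?f = "\<lambda>z t. exp (z * p t) / ((exp (p t) - 1) * p t ^ Suc k) * p' t"
  let ?fz = "\<lambda>z t. p t * exp (z * p t) / ((exp (p t) - 1) * p t ^ Suc k) * p' t"
  have d: "((\<lambda>z. ?f z t) has_field_derivative ?fz z t) (at z within UNIV)" for z t
    using nz[of t] by (auto intro!: derivative_eq_intros)
  have i: "?f z integrable_on cbox 0 1" for z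
    by (intro integrable_continuous continuous_intros cp ballI nz)
  have c: "continuous_on (UNIV \<times> cbox 0 1) (\<lambda>(z, t). ?fz z t)"
    unfolding case_prod_unfold
    by (intro continuous_intros continuous_on_compose2[OF cp(1)[of UNIV]] continuous_on_compose2[OF cp(2)[of UNIV]] ballI nz) auto
  have "((\<lambda>z. integral (cbox 0 1) (?f z)) has_field_derivative integral (cbox 0 1) (?fz z)) (at z within UNIV)" for z
    by (rule leibniz_rule_field_derivative[OF d i c]) auto
  then have "(\<lambda>z. integral (cbox 0 1) (?f z)) holomorphic_on UNIV"
    by (auto simp: holomorphic_on_def field_differentiable_def)
  moreover have "guichard k = (\<lambda>z. fact k / (2 * pi * \<i>) * integral (cbox 0 1) (?f z))"
    unfolding guichard_def[abs_def] contour_integral_integral p_def[symmetric] p'_def[symmetric] by (simp add: cbox_interval)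
  ultimately show ?thesis by (auto intro!: holomorphic_intros)
qed

section \<open>Plane waves\<close>

text \<open>
  The complex variable \<open>t + i (y \<bullet> \<omega>)\<close> of a plane wave. Its gradient \<open>(1, i \<omega>)\<close> is a null
  vector when \<open>\<omega>\<close> is a unit vector, and a shift of \<open>t\<close> by 1 is a shift of the variable by 1.
\<close>

definition phase :: "'b::euclidean_space \<Rightarrow> real \<times> 'b \<Rightarrow> complex" where
  "phase \<omega> x = of_real (fst x) + \<i> * of_real (snd x \<bullet> \<omega>)"

lemma bounded_linear_phase: "bounded_linear (phase \<omega>)"
  unfolding phase_def[abs_def]
  by (intro bounded_linear_intros bounded_linear_compose[OF bounded_linear_of_real]
      bounded_linear_compose[OF bounded_linear_const_mult])

lemma norm_phase_le:
  assumes "norm \<omega> = 1" shows "norm (phase \<omega> x) \<le> 2 * norm x"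
proof -
  have "norm (phase \<omega> x) \<le> \<bar>fst x\<bar> + \<bar>snd x \<bullet> \<omega>\<bar>"
    unfolding phase_def by (rule order_trans[OF norm_triangle_ineq]) (simp add: norm_mult)
  also have "\<bar>snd x \<bullet> \<omega>\<bar> \<le> norm (snd x)"
    using Cauchy_Schwarz_ineq2[of "snd x" \<omega>] assms by simp
  also have "\<bar>fst x\<bar> + norm (snd x) \<le> 2 * norm x"
    using norm_fst_le[of "fst x" "snd x"] norm_snd_le[of "snd x" "fst x"] by simp
  finally show ?thesis by simp
qed

lemma sum_phase_squares:
  fixes \<omega> :: "'b::euclidean_space"
  assumes "norm \<omega> = 1"
  shows "(\<Sum>b\<in>Basis. (phase \<omega> b)\<^sup>2) = 0"
proof -
  have "(\<Sum>b\<in>Basis. (phase \<omega> b)\<^sup>2) = 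
     (\<Sum>b\<in>(\<lambda>u. (u, 0)) ` Basis. (phase \<omega> b)\<^sup>2) + (\<Sum>b\<in>(\<lambda>v. (0, v)) ` Basis. (phase \<omega> b)\<^sup>2)"
    unfolding Basis_prod_def by (rule sum.union_disjoint) auto
  also have "(\<Sum>b\<in>(\<lambda>u. (u, 0)) ` Basis. (phase \<omega> b)\<^sup>2) = 1"
    by (subst sum.reindex) (auto simp: inj_on_def phase_def)
  also have "(\<Sum>b\<in>(\<lambda>v. (0, v)) ` Basis. (phase \<omega> b)\<^sup>2) = (\<Sum>v\<in>Basis. - of_real ((v \<bullet> \<omega>)\<^sup>2))"
    by (subst sum.reindex) (auto simp: inj_on_def phase_def power_mult_distrib)
  also have "\<dots> = - of_real (\<Sum>v\<in>Basis. (\<omega> \<bullet> v)\<^sup>2)"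
    by (simp add: sum_negf inner_commute)
  also have "(\<Sum>v\<in>Basis. (\<omega> \<bullet> v)\<^sup>2) = 1"
    using assms euclidean_inner[of \<omega> \<omega>] by (simp add: norm_eq_1 power2_eq_square)
  finally show ?thesis by simp
qed

text \<open>
  The Laplacian of \<open>F (phase \<omega> x)\<close> is the second derivative of \<open>F\<close> times the sum of the squares
  of the coefficients of the phase, which is \<open>1 - |\<omega>|\<^sup>2 = 0\<close>.
\<close>

lemma harmonic_plane_wave:
  fixes \<omega> :: "'b::euclidean_space"
  assumes F: "F holomorphic_on UNIV" and \<omega>: "norm \<omega> = 1"
  shows "harmonic_on UNIV (\<lambda>x. F (phase \<omega> x))"
    and "partial_deriv v (\<lambda>x. F (phase \<omega> x)) x = deriv F (phase \<omega> x) * phase \<omega> v"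
proof -
  let ?P = "phase \<omega>"
  define P where "P = Blinfun ?P"
  have P: "blinfun_apply P = ?P" unfolding P_def by (rule bounded_linear_Blinfun_apply[OF bounded_linear_phase])
  have dP: "(?P has_derivative ?P) (at x)" for x
    by (rule bounded_linear_imp_has_derivative[OF bounded_linear_phase])
  define L where "L = Blinfun (\<lambda>c. blinfun_mult_right c o\<^sub>L P)"
  have L: "blinfun_apply L c = blinfun_mult_right c o\<^sub>L P" for c
    unfolding L_def by (subst bounded_linear_Blinfun_apply)
      (auto intro!: bounded_linear_compose[OF bounded_bilinear.bounded_linear_left[OF bounded_bilinear_blinfun_compose]]
          bounded_linear_blinfun_mult_right)
  have holo: "deriv F holomorphic_on UNIV" "deriv (deriv F) holomorphic_on UNIV"
    using F by (auto intro!: holomorphic_deriv)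
  have chain: "((\<lambda>x. G (?P x)) has_derivative (\<lambda>v. deriv G (?P x) * ?P v)) (at x)" 
    if "G holomorphic_on UNIV" for G x
  proof -
    have "(G has_derivative (\<lambda>h. deriv G (?P x) * h)) (at (?P x))"
      using holomorphic_derivI[OF that, of "?P x"] by (simp add: has_field_derivative_def)
    from has_derivative_compose[OF dP this] show ?thesis .
  qed
  show "partial_deriv v (\<lambda>x. F (?P x)) x = deriv F (?P x) * ?P v"
    by (rule partial_deriv_eq[OF chain[OF F]])
  show "harmonic_on UNIV (\<lambda>x. F (?P x))"
  proof (rule harmonicI[where f' = "\<lambda>x. L (deriv F (?P x))" and f'' = "\<lambda>x. L o\<^sub>L L (deriv (deriv F) (?P x))"])
    fix x
    show "((\<lambda>x. F (?P x)) has_derivative blinfun_apply (L (deriv F (?P x)))) (at x)"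
      using chain[OF F, of x] by (simp add: L P o_def blinfun_compose.rep_eq)
    show "((\<lambda>x. L (deriv F (?P x))) has_derivative blinfun_apply (L o\<^sub>L L (deriv (deriv F) (?P x)))) (at x)"
      using bounded_linear.has_derivative[OF blinfun.bounded_linear_right[of L] chain[OF holo(1), of x]]
      by (simp add: L P o_def blinfun_compose.rep_eq)
    show "(\<Sum>b\<in>Basis. (L o\<^sub>L L (deriv (deriv F) (?P x))) b b) = 0"
      using sum_phase_squares[OF \<omega>] by (simp add: L P mult.assoc power2_eq_square flip: sum_distrib_left)
  next
    have "continuous_on UNIV (deriv (deriv F))" using holo(2) by (rule holomorphic_on_imp_continuous_on)
    then have "continuous_on UNIV (\<lambda>x. deriv (deriv F) (?P x))"
      by (rule continuous_on_compose2) (auto intro: linear_continuous_on bounded_linear_phase)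
    then show "continuous_on UNIV (\<lambda>x. L o\<^sub>L L (deriv (deriv F) (?P x)))"
      by (intro bounded_bilinear.continuous_on[OF bounded_bilinear_blinfun_compose] blinfun.continuous_on continuous_on_const)
  qed
qed

section \<open>Superpositions of plane waves\<close>

text \<open>
  Coefficient families with faster than geometric decay in the degree, and unit directions. The
  index sets depend on the degree because ever more directions are needed.
\<close>

definition plane_waves ::
  "(nat \<Rightarrow> 'i set) \<Rightarrow> (nat \<Rightarrow> 'i \<Rightarrow> complex) \<Rightarrow> (nat \<Rightarrow> 'i \<Rightarrow> 'b::euclidean_space) \<Rightarrow> bool" where
  "plane_waves J c \<omega> \<longleftrightarrow> (\<forall>k j. norm (\<omega> k j) = 1) \<and>
     (\<forall>R\<ge>0. summable (\<lambda>k. R ^ k * (\<Sum>j\<in>J k. norm (c k j))))"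

definition wave_term ::
  "(nat \<Rightarrow> 'i set) \<Rightarrow> (nat \<Rightarrow> 'i \<Rightarrow> complex) \<Rightarrow> (nat \<Rightarrow> 'i \<Rightarrow> 'b::euclidean_space) \<Rightarrow>
    (nat \<Rightarrow> complex \<Rightarrow> complex) \<Rightarrow> nat \<Rightarrow> real \<times> 'b \<Rightarrow> complex" where
  "wave_term J c \<omega> F k x = (\<Sum>j\<in>J k. c k j * F k (phase (\<omega> k j) x))"

definition wave_sum ::
  "(nat \<Rightarrow> 'i set) \<Rightarrow> (nat \<Rightarrow> 'i \<Rightarrow> complex) \<Rightarrow> (nat \<Rightarrow> 'i \<Rightarrow> 'b::euclidean_space) \<Rightarrow>
    (nat \<Rightarrow> complex \<Rightarrow> complex) \<Rightarrow> real \<times> 'b \<Rightarrow> complex" where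
  "wave_sum J c \<omega> F x = (\<Sum>k. wave_term J c \<omega> F k x)"

lemma plane_waves_mono:
  assumes "plane_waves J c \<omega>" "\<And>k j. norm (c' k j) \<le> norm (c k j)" "\<And>k j. norm (\<omega>' k j) = 1"
  shows "plane_waves J c' \<omega>'"
  unfolding plane_waves_def
proof (intro conjI allI impI)
  fix R :: real assume R: "R \<ge> 0"
  then have "summable (\<lambda>k. R ^ k * (\<Sum>j\<in>J k. norm (c k j)))" using assms(1) by (simp add: plane_waves_def)
  then show "summable (\<lambda>k. R ^ k * (\<Sum>j\<in>J k. norm (c' k j)))"
  proof (rule summable_comparison_test'[where N = 0])
    fix k
    have "R ^ k * (\<Sum>j\<in>J k. norm (c' k j)) \<le> R ^ k * (\<Sum>j\<in>J k. norm (c k j))"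
      using R assms(2) by (intro mult_left_mono sum_mono) auto
    then show "norm (R ^ k * (\<Sum>j\<in>J k. norm (c' k j))) \<le> R ^ k * (\<Sum>j\<in>J k. norm (c k j))"
      using R by (simp add: sum_nonneg)
  qed
qed (rule assms)

lemma plane_waves_shift:
  assumes "plane_waves J c \<omega>"
  shows "plane_waves (\<lambda>k. J (k - 1)) (\<lambda>k. c (k - 1)) (\<lambda>k. \<omega> (k - 1))"
  unfolding plane_waves_def
proof (intro conjI allI impI)
  fix R :: real assume R: "R \<ge> 0"
  then have "summable (\<lambda>k. R * (R ^ k * (\<Sum>j\<in>J k. norm (c k j))))" 
    using assms by (intro summable_mult) (simp add: plane_waves_def)
  then show "summable (\<lambda>k. R ^ k * (\<Sum>j\<in>J (k - 1). norm (c (k - 1) j)))"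
    by (subst summable_Suc_iff[symmetric]) (simp add: mult.assoc)
qed (use assms in \<open>simp add: plane_waves_def\<close>)

text \<open>
  The terms are bounded on the ball of radius \<open>R\<close> by a geometric sequence times the absolute sums
  of the coefficients, which is summable by the decay condition.
\<close>

lemma wave_sum_properties:
  fixes J :: "nat \<Rightarrow> 'i set" and \<omega> :: "nat \<Rightarrow> 'i \<Rightarrow> 'b::euclidean_space"
  assumes w: "plane_waves J c \<omega>" and F: "\<And>k. F k holomorphic_on UNIV"
    and bd: "\<And>R. \<exists>M\<ge>0. \<forall>k z. norm z \<le> R \<longrightarrow> norm (F k z) \<le> M ^ Suc k"
  shows "(\<lambda>k. wave_term J c \<omega> F k x) sums wave_sum J c \<omega> F x"
    and "harmonic_on UNIV (wave_sum J c \<omega> F)"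
    and "(\<lambda>k. \<Sum>j\<in>J k. c k j * (deriv (F k) (phase (\<omega> k j) x) * phase (\<omega> k j) v))
       sums partial_deriv v (wave_sum J c \<omega> F) x"
proof -
  have \<omega>: "norm (\<omega> k j) = 1" for k j using w by (simp add: plane_waves_def)
  have h: "harmonic_on UNIV (wave_term J c \<omega> F k)" for k
    unfolding wave_term_def[abs_def] by (intro harmonic_sum harmonic_mult harmonic_plane_wave F \<omega>)
  have "\<exists>B. summable B \<and> (\<forall>k x. norm x \<le> R \<longrightarrow> norm (wave_term J c \<omega> F k x) \<le> B k)" for R
  proof -
    obtain M where M: "M \<ge> 0" "\<And>k z. norm z \<le> 2 * R \<Longrightarrow> norm (F k z) \<le> M ^ Suc k" using bd[of "2 * R"] by blast
    have "norm (wave_term J c \<omega> F k x) \<le> M * (M ^ k * (\<Sum>j\<in>J k. norm (c k j)))" if "norm x \<le> R" for k x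
    proof -
      have "norm (wave_term J c \<omega> F k x) \<le> (\<Sum>j\<in>J k. norm (c k j) * M ^ Suc k)"
        unfolding wave_term_def
      proof (rule sum_norm_le)
        fix j assume "j \<in> J k"
        show "norm (c k j * F k (phase (\<omega> k j) x)) \<le> norm (c k j) * M ^ Suc k"
          unfolding norm_mult using order_trans[OF norm_phase_le[OF \<omega>]] that by (intro mult_left_mono M) auto
      qed
      then show ?thesis by (simp add: sum_distrib_left sum_distrib_right mult_ac)
    qed
    moreover have "summable (\<lambda>k. M * (M ^ k * (\<Sum>j\<in>J k. norm (c k j))))"
      using w M(1) by (intro summable_mult) (simp add: plane_waves_def)
    ultimately show ?thesis by (intro exI[of _ "\<lambda>k. M * (M ^ k * (\<Sum>j\<in>J k. norm (c k j)))"]) simp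
  qed
  note * = harmonic_suminf[OF h this]
  show "(\<lambda>k. wave_term J c \<omega> F k x) sums wave_sum J c \<omega> F x"
    unfolding wave_sum_def by (rule summable_sums[OF *(1)])
  show "harmonic_on UNIV (wave_sum J c \<omega> F)"
    unfolding wave_sum_def[abs_def] by (rule *(2))
  have "partial_deriv v (wave_term J c \<omega> F k) x = (\<Sum>j\<in>J k. c k j * (deriv (F k) (phase (\<omega> k j) x) * phase (\<omega> k j) v))" for k
    unfolding wave_term_def[abs_def]
    by (subst partial_deriv_sum_mult) (auto intro!: harmonic_plane_wave F \<omega> simp: harmonic_plane_wave(2)[OF F \<omega>])
  with *(3)[of v x] show "(\<lambda>k. \<Sum>j\<in>J k. c k j * (deriv (F k) (phase (\<omega> k j) x) * phase (\<omega> k j) v))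
       sums partial_deriv v (wave_sum J c \<omega> F) x"
    unfolding wave_sum_def[abs_def] by simp
qed

lemma power_wave_sum:
  fixes J :: "nat \<Rightarrow> 'i set" and \<omega> :: "nat \<Rightarrow> 'i \<Rightarrow> 'b::euclidean_space"
  assumes w: "plane_waves J c \<omega>"
  shows "(\<lambda>k. \<Sum>j\<in>J k. c k j * phase (\<omega> k j) x ^ k) sums wave_sum J c \<omega> (\<lambda>k z. z ^ k) x"
    and "harmonic_on UNIV (wave_sum J c \<omega> (\<lambda>k z. z ^ k))"
    and "(\<lambda>k. \<Sum>j\<in>J k. c k j * (of_nat k * phase (\<omega> k j) x ^ (k - 1) * phase (\<omega> k j) v))
       sums partial_deriv v (wave_sum J c \<omega> (\<lambda>k z. z ^ k)) x"
proof -
  have bd: "\<exists>M\<ge>0. \<forall>k (z::complex). norm z \<le> R \<longrightarrow> norm (z ^ k) \<le> M ^ Suc k" for R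
  proof (intro exI[of _ "\<bar>R\<bar> + 1"] conjI allI impI)
    fix k and z :: complex assume "norm z \<le> R"
    then have "norm (z ^ k) \<le> (\<bar>R\<bar> + 1) ^ k" unfolding norm_power by (intro power_mono) auto
    also have "\<dots> \<le> (\<bar>R\<bar> + 1) ^ Suc k" by (intro power_increasing) auto
    finally show "norm (z ^ k) \<le> (\<bar>R\<bar> + 1) ^ Suc k" .
  qed auto
  have hol: "(\<lambda>z::complex. z ^ k) holomorphic_on UNIV" for k by (intro holomorphic_intros)
  have d: "deriv (\<lambda>z::complex. z ^ k) z = of_nat k * z ^ (k - 1)" for k z
    by (rule DERIV_imp_deriv) (auto intro!: derivative_eq_intros)
  note * = wave_sum_properties[OF w hol bd]
  show "(\<lambda>k. \<Sum>j\<in>J k. c k j * phase (\<omega> k j) x ^ k) sums wave_sum J c \<omega> (\<lambda>k z. z ^ k) x"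
    using *(1)[of x] by (simp add: wave_term_def)
  show "harmonic_on UNIV (wave_sum J c \<omega> (\<lambda>k z. z ^ k))" by (rule *(2))
  show "(\<lambda>k. \<Sum>j\<in>J k. c k j * (of_nat k * phase (\<omega> k j) x ^ (k - 1) * phase (\<omega> k j) v))
       sums partial_deriv v (wave_sum J c \<omega> (\<lambda>k z. z ^ k)) x"
    using *(3)[of x v] by (simp add: d)
qed

section \<open>The difference equation for superpositions\<close>

definition unit_difference :: "(real \<times> 'b::euclidean_space \<Rightarrow> complex) \<Rightarrow> bool" where
  "unit_difference g \<longleftrightarrow> (\<exists>h. harmonic_on UNIV h \<and> (\<forall>t y. h (t + 1, y) - h (t, y) = g (t, y)))"

lemma unit_difference_add:
  assumes "unit_difference f" "unit_difference g"
  shows "unit_difference (\<lambda>x. f x + g x)"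
proof -
  obtain h1 h2 where "harmonic_on UNIV h1" "\<forall>t y. h1 (t + 1, y) - h1 (t, y) = f (t, y)"
     "harmonic_on UNIV h2" "\<forall>t y. h2 (t + 1, y) - h2 (t, y) = g (t, y)"
    using assms unfolding unit_difference_def by auto
  then show ?thesis unfolding unit_difference_def
    by (intro exI[of _ "\<lambda>x. h1 x + h2 x"]) (auto intro!: harmonic_add simp: algebra_simps)
qed

text \<open>
  In a plane wave the equation in \<open>t\<close> is the one-variable equation in the phase, so the powers are
  replaced by their solutions term by term.
\<close>

lemma unit_difference_power_wave_sum:
  fixes \<omega> :: "nat \<Rightarrow> 'i \<Rightarrow> 'b::euclidean_space"
  assumes w: "plane_waves J c \<omega>"
  shows "unit_difference (wave_sum J c \<omega> (\<lambda>k z. z ^ k))"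
proof -
  have bd: "\<exists>M\<ge>0. \<forall>k z. norm z \<le> R \<longrightarrow> norm (guichard k z) \<le> M ^ Suc k" for R
  proof (intro exI conjI allI impI)
    show "norm (guichard k z) \<le> (2 * exp (2 * pi * R)) ^ Suc k" if "norm z \<le> R" for k z
      by (rule guichard_bound[OF that])
  qed simp
  note * = wave_sum_properties[OF w guichard_holomorphic bd]
  have "wave_sum J c \<omega> guichard (t + 1, y) - wave_sum J c \<omega> guichard (t, y) = wave_sum J c \<omega> (\<lambda>k z. z ^ k) (t, y)" for t y
  proof -
    have p: "phase (\<omega> k j) (t + 1, y) = phase (\<omega> k j) (t, y) + 1" for k j by (simp add: phase_def)
    have "wave_term J c \<omega> guichard k (t + 1, y) - wave_term J c \<omega> guichard k (t, y) = 
        wave_term J c \<omega> (\<lambda>k z. z ^ k) k (t, y)" for k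
      unfolding wave_term_def p by (simp add: guichard_difference flip: sum_subtractf right_diff_distrib)
    with sums_diff[OF *(1)[of "(t + 1, y)"] *(1)[of "(t, y)"]] show ?thesis
      by (simp add: wave_sum_def[of _ _ _ "\<lambda>k z. z ^ k"] sums_iff)
  qed
  with *(2) show ?thesis unfolding unit_difference_def by blast
qed

lemma phase_time_0: "phase \<omega> (0, y) = \<i> * of_real (y \<bullet> \<omega>)"
  by (simp add: phase_def)

lemma phase_time_direction: "phase \<omega> (1, 0) = 1"
  by (simp add: phase_def)

lemma imaginary_unit_powers:
  fixes z :: complex
  shows "(- \<i>) ^ n * (\<i> * z) ^ n = z ^ n" "\<i> ^ n * (\<i> * - z) ^ n = z ^ n"
  by (simp_all flip: power_mult_distrib)

text \<open>
  A power \<open>(y \<bullet> \<omega>)\<^sup>k\<close> on the hyperplane \<open>t = 0\<close> is the value of \<open>i\<^sup>-\<^sup>k z\<^sup>k\<close> for the phase \<open>z\<close>. Averaging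
  with the reflected wave, whose phase is up to sign that of \<open>-\<omega>\<close>, gives the extension that is even
  in \<open>t\<close>, hence has zero normal derivative. The powers of \<open>-i\<close> and \<open>i\<close> in the coefficients are
  \<open>i\<^sup>-\<^sup>k\<close> and \<open>(-1)\<^sup>k i\<^sup>-\<^sup>k\<close>.
\<close>

lemma even_wave_extension:
  fixes \<omega> :: "nat \<Rightarrow> 'i \<Rightarrow> 'b::euclidean_space"
  assumes w: "plane_waves J c \<omega>"
    and a: "\<And>y. (\<lambda>k. \<Sum>j\<in>J k. c k j * of_real (y \<bullet> \<omega> k j) ^ k) sums a y"
  obtains g where "harmonic_on UNIV g" "unit_difference g" "\<And>y. g (0, y) = a y"
    "\<And>y. partial_deriv (1, 0) g (0, y) = 0"
proof -
  define c1 where "c1 k j = c k j * (- \<i>) ^ k / 2" for k j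
  define c2 where "c2 k j = c k j * \<i> ^ k / 2" for k j
  have \<omega>: "norm (\<omega> k j) = 1" for k j using w by (simp add: plane_waves_def)
  have w1: "plane_waves J c1 \<omega>"
    by (rule plane_waves_mono[OF w]) (auto simp: c1_def norm_mult norm_divide norm_power \<omega>)
  have w2: "plane_waves J c2 (\<lambda>k j. - \<omega> k j)"
    by (rule plane_waves_mono[OF w]) (auto simp: c2_def norm_mult norm_divide norm_power \<omega>)
  let ?g1 = "wave_sum J c1 \<omega> (\<lambda>k z. z ^ k)" and ?g2 = "wave_sum J c2 (\<lambda>k j. - \<omega> k j) (\<lambda>k z. z ^ k)"
  note p1 = power_wave_sum[OF w1] and p2 = power_wave_sum[OF w2]
  show ?thesis
  proof
    show "harmonic_on UNIV (\<lambda>x. ?g1 x + ?g2 x)" by (intro harmonic_add p1 p2)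
    show "unit_difference (\<lambda>x. ?g1 x + ?g2 x)" 
      by (intro unit_difference_add unit_difference_power_wave_sum w1 w2)
    fix y
    have "c1 k j * phase (\<omega> k j) (0, y) ^ k + c2 k j * phase (- \<omega> k j) (0, y) ^ k = c k j * of_real (y \<bullet> \<omega> k j) ^ k" for k j
    proof -
      have "c1 k j * phase (\<omega> k j) (0, y) ^ k = c k j / 2 * ((- \<i>) ^ k * (\<i> * of_real (y \<bullet> \<omega> k j)) ^ k)"
        by (simp only: c1_def phase_time_0) simp
      moreover have "c2 k j * phase (- \<omega> k j) (0, y) ^ k = c k j / 2 * (\<i> ^ k * (\<i> * - of_real (y \<bullet> \<omega> k j)) ^ k)"
        by (simp only: c2_def phase_time_0 inner_minus_right of_real_minus) simp
      ultimately show ?thesis by (simp only: imaginary_unit_powers) simp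
    qed
    with sums_add[OF p1(1)[of "(0, y)"] p2(1)[of "(0, y)"]] a[of y]
    show "?g1 (0, y) + ?g2 (0, y) = a y" 
      by (simp add: sums_iff flip: sum.distrib)
    have "c1 k j * (of_nat k * phase (\<omega> k j) (0, y) ^ (k - 1) * phase (\<omega> k j) (1, 0)) + 
       c2 k j * (of_nat k * phase (- \<omega> k j) (0, y) ^ (k - 1) * phase (- \<omega> k j) (1, 0)) = 0" for k j
    proof (cases k)
      case (Suc n)
      have "(- \<i>) ^ Suc n * (\<i> * of_real s) ^ n + \<i> ^ Suc n * (\<i> * - of_real s) ^ n = 0" for s :: real
        by (simp only: power_Suc mult.assoc imaginary_unit_powers) simp
      note 1 = this[of "y \<bullet> \<omega> k j"]
      have "c1 k j * (of_nat k * phase (\<omega> k j) (0, y) ^ (k - 1) * phase (\<omega> k j) (1, 0)) = 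
        c k j / 2 * of_nat k * ((- \<i>) ^ Suc n * (\<i> * of_real (y \<bullet> \<omega> k j)) ^ n)"
        using Suc by (simp add: c1_def phase_time_0 phase_time_direction)
      moreover have "c2 k j * (of_nat k * phase (- \<omega> k j) (0, y) ^ (k - 1) * phase (- \<omega> k j) (1, 0)) = 
        c k j / 2 * of_nat k * (\<i> ^ Suc n * (\<i> * - of_real (y \<bullet> \<omega> k j)) ^ n)"
        using Suc by (simp add: c2_def phase_time_0 phase_time_direction)
      ultimately show ?thesis by (simp only: distrib_left[symmetric] 1 mult_zero_right)
    qed simp
    with sums_add[OF p1(3)[of "(0, y)" "(1, 0)"] p2(3)[of "(0, y)" "(1, 0)"]]
    have "partial_deriv (1, 0) ?g1 (0, y) + partial_deriv (1, 0) ?g2 (0, y) = 0"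
      by (simp add: sums_iff flip: sum.distrib)
    moreover have "partial_deriv (1, 0) (\<lambda>x. ?g1 x + ?g2 x) (0, y) = 
       partial_deriv (1, 0) ?g1 (0, y) + partial_deriv (1, 0) ?g2 (0, y)"
      by (rule partial_deriv_eq) (intro has_derivative_add harmonic_differentiable p1 p2)
    ultimately show "partial_deriv (1, 0) (\<lambda>x. ?g1 x + ?g2 x) (0, y) = 0" by simp
  qed
qed

text \<open>
  The primitives in \<open>t\<close> of the waves of the even extension are odd in \<open>t\<close>, so they vanish at \<open>t = 0\<close>
  and have the prescribed normal derivative. Taking primitives raises the degree by one, which is
  why the families are shifted.
\<close>

lemma odd_wave_extension:
  fixes \<omega> :: "nat \<Rightarrow> 'i \<Rightarrow> 'b::euclidean_space"
  assumes w: "plane_waves J c \<omega>"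
    and b: "\<And>y. (\<lambda>k. \<Sum>j\<in>J k. c k j * of_real (y \<bullet> \<omega> k j) ^ k) sums b y"
  obtains g where "harmonic_on UNIV g" "unit_difference g" "\<And>y. g (0, y) = 0"
    "\<And>y. partial_deriv (1, 0) g (0, y) = b y"
proof -
  define J' where "J' k = J (k - 1)" for k
  define \<omega>' where "\<omega>' k = \<omega> (k - 1)" for k
  \<comment> \<open>The coefficients with \<open>k = 0\<close> are zero, since they have the denominator 0.\<close>
  define c1 where "c1 k j = c (k - 1) j * (- \<i>) ^ (k - 1) / of_nat (2 * k)" for k j
  define c2 where "c2 k j = c (k - 1) j * \<i> ^ (k - 1) / of_nat (2 * k)" for k j
  have \<omega>: "norm (\<omega>' k j) = 1" for k j using w by (simp add: plane_waves_def \<omega>'_def)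
  have le: "x / (2 * real k) \<le> x" if "x \<ge> 0" for x k
    using that by (cases "k = 0") (auto simp: divide_le_eq mult_le_cancel_left1 intro: order_trans[of _ "x * 1"])
  have w1: "plane_waves J' c1 \<omega>'"
    unfolding J'_def by (rule plane_waves_mono[OF plane_waves_shift[OF w]]) 
      (auto simp: c1_def norm_mult norm_divide norm_power \<omega> le)
  have w2: "plane_waves J' c2 (\<lambda>k j. - \<omega>' k j)"
    unfolding J'_def by (rule plane_waves_mono[OF plane_waves_shift[OF w]]) 
      (auto simp: c2_def norm_mult norm_divide norm_power \<omega> le)
  let ?g1 = "wave_sum J' c1 \<omega>' (\<lambda>k z. z ^ k)" and ?g2 = "wave_sum J' c2 (\<lambda>k j. - \<omega>' k j) (\<lambda>k z. z ^ k)"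
  note p1 = power_wave_sum[OF w1] and p2 = power_wave_sum[OF w2]
  show ?thesis
  proof
    show "harmonic_on UNIV (\<lambda>x. ?g1 x + ?g2 x)" by (intro harmonic_add p1 p2)
    show "unit_difference (\<lambda>x. ?g1 x + ?g2 x)" 
      by (intro unit_difference_add unit_difference_power_wave_sum w1 w2)
    fix y
    have "c1 k j * phase (\<omega>' k j) (0, y) ^ k + c2 k j * phase (- \<omega>' k j) (0, y) ^ k = 0" for k j
    proof (cases k)
      case (Suc n)
      have "(- \<i>) ^ n * (\<i> * of_real s) ^ Suc n + \<i> ^ n * (\<i> * - of_real s) ^ Suc n = 0" for s :: real
        by (simp only: power_Suc2 mult.assoc[symmetric] imaginary_unit_powers) simp
      from arg_cong[OF this, of "\<lambda>z. c n j / of_nat (2 * k) * z" "y \<bullet> \<omega> n j"] show ?thesis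
        unfolding c1_def c2_def \<omega>'_def phase_time_0 using Suc by (simp add: algebra_simps)
    qed (simp add: c1_def c2_def)
    with sums_add[OF p1(1)[of "(0, y)"] p2(1)[of "(0, y)"]]
    show "?g1 (0, y) + ?g2 (0, y) = 0"
      by (simp add: sums_iff flip: sum.distrib)
    let ?s = "\<lambda>k j. c1 k j * (of_nat k * phase (\<omega>' k j) (0, y) ^ (k - 1) * phase (\<omega>' k j) (1, 0)) + 
       c2 k j * (of_nat k * phase (- \<omega>' k j) (0, y) ^ (k - 1) * phase (- \<omega>' k j) (1, 0))"
    have s: "?s (Suc n) j = c n j * of_real (y \<bullet> \<omega> n j) ^ n" for n j
    proof -
      have "(- \<i>) ^ n * (\<i> * of_real s) ^ n + \<i> ^ n * (\<i> * - of_real s) ^ n = 2 * of_real s ^ n" for s :: real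
        by (simp only: imaginary_unit_powers) simp
      note 1 = arg_cong[OF this, of "\<lambda>z. c n j / 2 * z" "y \<bullet> \<omega> n j"]
      have 2: "A / of_nat (2 * Suc n) * (of_nat (Suc n) * B * 1) = A / 2 * B" for A B :: complex
        unfolding of_nat_mult by (simp add: field_simps del: of_nat_Suc)
      show ?thesis
        unfolding c1_def c2_def \<omega>'_def phase_time_0 phase_time_direction 2 diff_Suc_1 inner_minus_right of_real_minus
        using 1 by (simp add: algebra_simps)
    qed
    have "(\<lambda>k. \<Sum>j\<in>J' k. ?s k j) sums (partial_deriv (1, 0) ?g1 (0, y) + partial_deriv (1, 0) ?g2 (0, y))"
      using sums_add[OF p1(3)[of "(0, y)" "(1, 0)"] p2(3)[of "(0, y)" "(1, 0)"]] by (simp add: sum.distrib)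
    then have "(\<lambda>n. \<Sum>j\<in>J' (Suc n). ?s (Suc n) j) sums (partial_deriv (1, 0) ?g1 (0, y) + partial_deriv (1, 0) ?g2 (0, y))"
      by (subst sums_Suc_iff) simp
    then have "partial_deriv (1, 0) ?g1 (0, y) + partial_deriv (1, 0) ?g2 (0, y) = b y"
      unfolding s using b[of y] by (simp add: J'_def sums_iff)
    moreover have "partial_deriv (1, 0) (\<lambda>x. ?g1 x + ?g2 x) (0, y) = 
       partial_deriv (1, 0) ?g1 (0, y) + partial_deriv (1, 0) ?g2 (0, y)"
      by (rule partial_deriv_eq) (intro has_derivative_add harmonic_differentiable p1 p2)
    ultimately show "partial_deriv (1, 0) (\<lambda>x. ?g1 x + ?g2 x) (0, y) = b y" by simp
  qed
qed

section \<open>Harmonic functions as superpositions of plane waves\<close>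

lemma signed_bases_bounds:
  assumes "js \<in> signed_bases k"
  shows "norm (signed_sum js) \<le> k" "\<bar>sign_prod js\<bar> = 1"
proof -
  have "norm (signed_sum js) \<le> length js \<and> \<bar>sign_prod js\<bar> = 1" if "set js \<subseteq> Basis \<times> {1, -1}"
    using that
  proof (induction js)
    case (Cons j js)
    obtain b \<epsilon> where j: "j = (b, \<epsilon>)" "b \<in> Basis" "\<bar>\<epsilon>\<bar> = 1" using Cons.prems by (cases j) auto
    have "norm (\<epsilon> *\<^sub>R b + signed_sum js) \<le> 1 + length js"
      by (rule order_trans[OF norm_triangle_ineq]) (use Cons j in auto)
    with Cons j show ?case by (simp add: abs_mult)
  qed simp
  with assms show "norm (signed_sum js) \<le> k" "\<bar>sign_prod js\<bar> = 1"
    by (auto simp: signed_bases_def)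
qed

text \<open>
  The Taylor series of \<open>f\<close> at 0 in the direction \<open>(0, y)\<close>, polarized. The vectors produced by polarization
  have length at most \<open>k\<close> in degree \<open>k\<close>; normalizing them costs a factor \<open>k\<^sup>k\<close>. This factor and the
  number \<open>(2 n)\<^sup>k\<close> of summands, where \<open>n\<close> is the dimension of the whole space, are absorbed by the two
  factorials in the denominator and the decay of the derivatives.
\<close>

lemma slice_expansion:
  fixes f :: "real \<times> 'b::euclidean_space \<Rightarrow> complex"
  assumes f: "harmonic_on UNIV f"
  obtains c and \<omega> :: "nat \<Rightarrow> ((real \<times> 'b) \<times> real) list \<Rightarrow> 'b"
  where "plane_waves signed_bases c \<omega>"
    "\<And>y. (\<lambda>k. \<Sum>js\<in>signed_bases k. c k js * of_real (y \<bullet> \<omega> k js) ^ k) sums f (0, y)"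
proof -
  let ?n = "DIM(real \<times> 'b)"
  define w :: "((real \<times> 'b) \<times> real) list \<Rightarrow> 'b" where "w js = snd (signed_sum js)" for js
  obtain u :: 'b where u: "norm u = 1" using vector_choose_size[of 1] by auto
  \<comment> \<open>A zero vector contributes nothing except in degree 0, where its power is 1 and so is
     that of an arbitrary unit vector.\<close>
  define \<omega> where "\<omega> k js = (if w js = 0 then u else sgn (w js))" for k :: nat and js
  define \<alpha> where "\<alpha> k js = sign_prod js * norm (w js) ^ k / (2 ^ k * (fact k * fact k))" for k and js :: "((real \<times> 'b) \<times> real) list"
  define D where "D js = foldr partial_deriv (map fst js) f 0" for js :: "((real \<times> 'b) \<times> real) list"
  define c where "c k js = of_real (\<alpha> k js) * D js" for k js
  have \<omega>: "norm (\<omega> k js) = 1" for k js by (simp add: \<omega>_def u norm_sgn)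
  have \<omega>w: "norm (w js) ^ k * (y \<bullet> \<omega> k js) ^ k = (y \<bullet> w js) ^ k" for k js y
    by (cases "w js = 0"; cases k) (auto simp: \<omega>_def sgn_div_norm field_simps simp flip: power_mult_distrib)
  have "plane_waves signed_bases c \<omega>"
    unfolding plane_waves_def
  proof (intro conjI allI impI)
    fix R :: real assume R: "R \<ge> 0"
    \<comment> \<open>Chosen such that the terms of degree \<open>k\<close> are at most \<open>2\<^sup>-\<^sup>k\<close> times a constant; \<open>R + 1\<close> avoids
       a division by zero.\<close>
    define A where "A = 1 / (2 * (?n * exp 1 * (R + 1)))"
    have pos: "?n * exp 1 * (R + 1) > 0" using R by (intro mult_pos_pos) auto
    then have A: "A > 0" by (simp add: A_def)
    have AR: "R * (?n * exp 1 * A) \<le> 1/2"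
    proof -
      have "R * (?n * exp 1 * A) \<le> (R + 1) * (?n * exp 1 * A)" using A by (intro mult_right_mono) auto
      also have "\<dots> = (?n * exp 1 * (R + 1)) * A" by (simp only: mult_ac)
      also have "\<dots> = 1/2" using pos R unfolding A_def by simp
      finally show ?thesis .
    qed
    obtain M where M: "M \<ge> 0" "\<And>vs x. \<lbrakk>\<And>v. v \<in> set vs \<Longrightarrow> norm v \<le> 1; norm x \<le> 0\<rbrakk> \<Longrightarrow>
        norm (foldr partial_deriv vs f x) \<le> A ^ length vs * fact (length vs) * M"
      by (rule iterated_derivatives_bound[OF f A, of 1 0]) auto
    have cb: "norm (c k js) \<le> (exp 1 * A / 2) ^ k * M" if js: "js \<in> signed_bases k" for k js
    proof -
      have "norm v \<le> 1" if "v \<in> set (map fst js)" for v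
        using js that by (auto simp: signed_bases_def)
      from M(2)[of "map fst js" 0, OF this] have D: "norm (D js) \<le> A ^ k * fact k * M"
        using js by (simp add: D_def signed_bases_def)
      have "norm (w js) \<le> k"
        using signed_bases_bounds(1)[OF js] norm_snd_le[of "snd (signed_sum js)" "fst (signed_sum js)"] by (simp add: w_def)
      then have "norm (w js) ^ k \<le> real k ^ k" by (intro power_mono) auto
      also have "\<dots> \<le> fact k * exp (real k)" by (rule power_le_fact_exp) simp
      finally have "norm (w js) ^ k / (2 ^ k * (fact k * fact k)) \<le> fact k * exp (real k) / (2 ^ k * (fact k * fact k))"
        by (rule divide_right_mono) simp
      then have "\<bar>\<alpha> k js\<bar> \<le> fact k * exp (real k) / (2 ^ k * (fact k * fact k))"
        using signed_bases_bounds(2)[OF js] by (simp only: \<alpha>_def abs_divide abs_mult) simp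
      then have "norm (c k js) \<le> fact k * exp (real k) / (2 ^ k * (fact k * fact k)) * (A ^ k * fact k * M)"
        unfolding c_def norm_mult norm_of_real by (intro mult_mono D) auto
      also have "\<dots> = (exp 1 * A / 2) ^ k * M"
        by (simp add: power_mult_distrib power_divide flip: exp_of_nat_mult)
      finally show ?thesis .
    qed
    have "R ^ k * (\<Sum>js\<in>signed_bases k. norm (c k js)) \<le> M * (1/2) ^ k" for k
    proof -
      have "(\<Sum>js\<in>signed_bases k. norm (c k js)) \<le> real (card (signed_bases k :: ((real \<times> 'b) \<times> real) list set)) * ((exp 1 * A / 2) ^ k * M)"
        by (rule sum_bounded_above) (rule cb)
      then have "R ^ k * (\<Sum>js\<in>signed_bases k. norm (c k js)) \<le> R ^ k * (real ((2 * ?n) ^ k) * ((exp 1 * A / 2) ^ k * M))"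
        unfolding card_signed_bases using R by (intro mult_left_mono) auto
      also have "\<dots> = (R * (2 * real ?n * (exp 1 * A / 2))) ^ k * M"
        by (simp only: of_nat_power of_nat_mult of_nat_numeral mult.assoc power_mult_distrib)
      also have "R * (2 * real ?n * (exp 1 * A / 2)) = R * (?n * exp 1 * A)"
        by (simp add: algebra_simps)
      also have "(R * (?n * exp 1 * A)) ^ k * M \<le> (1/2) ^ k * M"
        using AR R A M(1) by (intro mult_right_mono power_mono) auto
      finally show ?thesis by (simp add: mult.commute)
    qed
    then have "norm (R ^ k * (\<Sum>js\<in>signed_bases k. norm (c k js))) \<le> M * (1/2) ^ k" for k
      using R by (subst real_norm_def, subst abs_of_nonneg) (auto intro!: mult_nonneg_nonneg sum_nonneg)
    moreover have "summable (\<lambda>k. M * (1/2) ^ k)" by (intro summable_mult summable_geometric) simp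
    ultimately show "summable (\<lambda>k. R ^ k * (\<Sum>js\<in>signed_bases k. norm (c k js)))"
      by (rule summable_comparison_test'[where N = 0, rotated])
  qed (rule \<omega>)
  moreover have "(\<lambda>k. \<Sum>js\<in>signed_bases k. c k js * of_real (y \<bullet> \<omega> k js) ^ k) sums f (0, y)" for y
  proof -
    let ?v = "(0::real, y)"
    have "(\<Sum>js\<in>signed_bases k. c k js * of_real (y \<bullet> \<omega> k js) ^ k) = (partial_deriv ?v ^^ k) f 0 / fact k" for k
    proof -
      have "c k js * of_real (y \<bullet> \<omega> k js) ^ k = of_real (sign_prod js * (0 + ?v \<bullet> signed_sum js) ^ k) * D js / (2 ^ k * (fact k * fact k))" for js
      proof -
        have "?v \<bullet> signed_sum js = y \<bullet> w js" by (cases "signed_sum js") (simp add: w_def)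
        then have "sign_prod js * (0 + ?v \<bullet> signed_sum js) ^ k = sign_prod js * (norm (w js) ^ k * (y \<bullet> \<omega> k js) ^ k)"
          by (simp only: \<omega>w) simp
        then show ?thesis by (simp only: c_def \<alpha>_def) simp
      qed
      then have "(\<Sum>js\<in>signed_bases k. c k js * of_real (y \<bullet> \<omega> k js) ^ k) = 
        (\<Sum>js\<in>signed_bases k. of_real (sign_prod js * (0 + ?v \<bullet> signed_sum js) ^ k) * foldr partial_deriv (map fst js) f 0) / (2 ^ k * (fact k * fact k))"
        by (simp only: sum_divide_distrib D_def)
      also have "\<dots> = 2 ^ k * fact k * (partial_deriv ?v ^^ k) f 0 / (2 ^ k * (fact k * fact k))"
        by (subst polarization[OF f order_refl]) simp
      also have "\<dots> = (partial_deriv ?v ^^ k) f 0 / fact k" by simp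
      finally show ?thesis .
    qed
    with harmonic_taylor[OF f, of ?v 0] show ?thesis by simp
  qed
  ultimately show ?thesis by (rule that)
qed

theorem theorem2:
  fixes g :: "real \<times> (real ^ 'd) \<Rightarrow> complex"
  assumes "harmonic_on UNIV g"
  shows "\<exists>h :: real \<times> (real ^ 'd) \<Rightarrow> complex.
    harmonic_on UNIV h \<and> (\<forall>t y. h (t + 1, y) - h (t, y) = g (t, y))"
proof -
  let ?e = "(1, 0) :: real \<times> (real ^ 'd)"
  obtain c0 and \<omega>0 :: "nat \<Rightarrow> ((real \<times> (real ^ 'd)) \<times> real) list \<Rightarrow> real ^ 'd" where 0: "plane_waves signed_bases c0 \<omega>0"
    "\<And>y. (\<lambda>k. \<Sum>js\<in>signed_bases k. c0 k js * of_real (y \<bullet> \<omega>0 k js) ^ k) sums g (0, y)"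
    using slice_expansion[OF assms] by blast
  obtain g0 where g0: "harmonic_on UNIV g0" "unit_difference g0" "\<And>y. g0 (0, y) = g (0, y)"
    "\<And>y. partial_deriv ?e g0 (0, y) = 0"
    using even_wave_extension[OF 0] by blast
  obtain c1 and \<omega>1 :: "nat \<Rightarrow> ((real \<times> (real ^ 'd)) \<times> real) list \<Rightarrow> real ^ 'd" where 1: "plane_waves signed_bases c1 \<omega>1"
    "\<And>y. (\<lambda>k. \<Sum>js\<in>signed_bases k. c1 k js * of_real (y \<bullet> \<omega>1 k js) ^ k) sums partial_deriv ?e g (0, y)"
    using slice_expansion[OF harmonic_partial_deriv[OF assms, of ?e]] by blast
  obtain g1 where g1: "harmonic_on UNIV g1" "unit_difference g1" "\<And>y. g1 (0, y) = 0"
    "\<And>y. partial_deriv ?e g1 (0, y) = partial_deriv ?e g (0, y)"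
    using odd_wave_extension[OF 1] by blast
  \<comment> \<open>The even and the odd extension together have the Cauchy data of \<open>g\<close>, hence they are \<open>g\<close>.\<close>
  define d where "d x = g x - (g0 x + g1 x)" for x
  have d: "harmonic_on UNIV d"
    unfolding d_def[abs_def] by (intro harmonic_diff harmonic_add assms g0 g1)
  have d': "partial_deriv ?e d x = partial_deriv ?e g x - (partial_deriv ?e g0 x + partial_deriv ?e g1 x)" for x
    unfolding d_def[abs_def]
    by (rule partial_deriv_eq) (intro has_derivative_diff has_derivative_add harmonic_differentiable assms g0 g1)
  have "d x = 0" for x
  proof (rule harmonic_eq_0_from_cauchy_data[OF d, of ?e])
    show "?e \<in> Basis" by (simp add: Basis_prod_def)
    fix z assume "z \<bullet> ?e = 0"
    then have z: "z = (0, snd z)" by (cases z) simp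
    show "d z = 0" by (subst z) (simp add: d_def g0 g1)
    show "partial_deriv ?e d z = 0" by (subst z) (simp add: d' g0 g1)
  qed
  then have "g = (\<lambda>x. g0 x + g1 x)" by (auto simp: d_def fun_eq_iff)
  then have "unit_difference g" using unit_difference_add[OF g0(2) g1(2)] by simp
  then show ?thesis by (simp add: unit_difference_def)
qed

end
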